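(* Let $\{\pi_k\}_{k\ge0}$ be the sequence of policies generated by PMD with mirror map $h(p)=\sum_a\psi(p(a))$ and a constant step size $\eta>0$. If $\psi'(0^+)>-\infty$ and $\psi'(1^-)=+\infty$, then the policy sequence converges to an optimal policy $\pi_\infty$, i.e. $\lim_{k\to\infty}\pi_k=\pi_\infty\in\Pi^*$. Moreover, $\pi_\infty$ satisfies: (i) $\pi_\infty(a'|s)=0$ for all $s\in\mathcal S$ and $a'\notin\mathcal A_s^*$; (ii) $\pi_\infty(a^*|s)=1$ for all $s\in\mathcal S_{=1}$ and $a^*\in\mathcal A_s^*$; (iii) $\pi_\infty(a^*|s)\in\mathrm{int}\,\mathrm{dom}\,\psi$ for all $s\in\mathcal S_{>1}$ and $a^*\in\mathcal A_s^*$.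
   Context: MDP: $(\mathcal S,\mathcal A,P,r,\gamma)$ is a finite discounted Markov decision process: finite state space $\mathcal S$, finite action space $\mathcal A$, transition model $P(\cdot|s,a)\in\Delta(\mathcal S)$, reward $r:\mathcal S\times\mathcal A\to[0,1]$, discount $\gamma\in[0,1)$. $\Delta(\mathcal X)$ is the probability simplex over a finite set $\mathcal X$. A policy $\pi$ assigns to each $s$ a distribution $\pi(\cdot|s)\in\Delta(\mathcal A)$; $\Pi$ is the set of all policies. $V^\pi(s)$ is the expected value of $\sum_{t\ge0}\gamma^t r(s_t,a_t)$ given $s_0=s$, $a_t\sim\pi(\cdot|s_t)$, $s_{t+1}\sim P(\cdot|s_t,a_t)$, and $Q^\pi(s,a)$ is the same conditioned on $(s_0,a_0)=(s,a)$. $V^*(s)=\max_{\pi\in\Pi}V^\pi(s)$, $Q^*(s,a)=\max_{\pi\in\Pi}Q^\pi(s,a)$; $\Pi^*$ is the set of optimal policies ($V^\pi=V^*$). $\mathcal A^*_s=\{a: Q^*(s,a)=V^*(s)\}$, $\mathcal S_{=1}=\{s:|\mathcal A_s^*|=1\}$, $\mathcal S_{>1}=\{s:|\mathcal A_s^*|>1\}$, $\tilde{\mathcal S}=\{s:\mathcal A_s^*\ne\mathcal A\}$, the last assumed nonempty throughout. Mirror map: $\psi:\mathbb R\to(-\infty,+\infty]$ satisfies: (a) $\mathrm{dom}\,\psi\supseteq[0,1]$; (b) $\psi$ is proper, closed and convex; (c) $\psi$ is differentiable on $\mathrm{int}\,\mathrm{dom}\,\psi$ and $|\psi'(x_n)|\to\infty$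 for every sequence $\{x_n\}\subseteq\mathrm{int}\,\mathrm{dom}\,\psi$ converging to a boundary point of $\mathrm{dom}\,\psi$; (d) $\psi$ is strictly convex on $\mathrm{int}\,\mathrm{dom}\,\psi$. $\psi'(0^+)$ and $\psi'(1^-)$ are the one-sided limits of $\psi'$ at $0$ from the right and at $1$ from the left. $h(p)=\sum_{a\in\mathcal A}\psi(p(a))$ and $D_h(p\|q)=h(p)-h(q)-\langle\nabla h(q),p-q\rangle$. PMD: given $\eta>0$ and an initial policy $\pi_0$ with $\pi_0(a|s)\in\mathrm{int}\,\mathrm{dom}\,\psi$ for all $(s,a)$ (assumed throughout), for each $s$, $\pi_{k+1}(\cdot|s)=\arg\max_{p\in\Delta(\mathcal A)}\{\eta\langle p,Q^{\pi_k}(s,\cdot)\rangle-D_h(p\|\pi_k(\cdot|s))\}$; all iterates satisfy $\pi_k(a|s)\in\mathrm{int}\,\mathrm{dom}\,\psi$. *)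

theory Defs
  imports "HOL-Probability.Probability"
begin

section \<open>Discounted Markov decision processes\<close>

text \<open>
  The probability simplex over a finite set is the type of probability mass functions over a
  finite type. Accordingly, a transition model has type \<open>'s \<Rightarrow> 'a \<Rightarrow> 's pmf\<close> and every element of
  type \<open>'s \<Rightarrow> 'a pmf\<close> is a policy.
\<close>

definition chain_kernel ::
    "'x pmf \<Rightarrow> ('x \<Rightarrow> 'x pmf) \<Rightarrow> nat \<Rightarrow> (nat \<Rightarrow> 'x) \<Rightarrow> 'x measure" where
  "chain_kernel \<mu> K n \<omega> = measure_pmf (if n = 0 then \<mu> else K (\<omega> (n - 1)))"

lemma Ionescu_Tulcea_chain_kernel:
  "Ionescu_Tulcea (chain_kernel \<mu> K) (\<lambda>_. count_space UNIV :: 'x::countable measure)"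
proof (rule Ionescu_Tulcea.intro)
  fix i
  have pmf_kernel: "(\<lambda>x. measure_pmf (L x)) \<in>
      measurable (count_space UNIV) (subprob_algebra (count_space UNIV))" for L :: "'x \<Rightarrow> 'x pmf"
    unfolding measurable_count_space_eq1 by (intro Pi_I measure_pmf_in_subprob_algebra)
  show "chain_kernel \<mu> K i \<in>
    measurable (PiM {0..<i} (\<lambda>_. count_space UNIV)) (subprob_algebra (count_space UNIV))"
  proof (cases "i = 0")
    case True
    then have "chain_kernel \<mu> K i = (\<lambda>_. measure_pmf \<mu>)"
      by (simp add: chain_kernel_def fun_eq_iff)
    then show ?thesis
      using measurable_const[OF measure_pmf_in_subprob_algebra] by metis
  next
    case False
    then have "i - 1 \<in> {0..<i}"
      by simp
    then have "(\<lambda>\<omega>. \<omega> (i - 1)) \<in>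
        measurable (PiM {0..<i} (\<lambda>_. count_space UNIV)) (count_space (UNIV :: 'x set))"
      by (rule measurable_component_singleton)
    from measurable_compose[OF this pmf_kernel] False show ?thesis
      by (simp only: chain_kernel_def[abs_def] if_False)
  qed
next
  fix i and \<omega> :: "nat \<Rightarrow> 'x"
  show "prob_space (chain_kernel \<mu> K i \<omega>)"
    unfolding chain_kernel_def by (rule measure_pmf.prob_space_axioms)
qed

text \<open>
  The law, on the product space of infinite paths, of the Markov chain with initial distribution
  \<open>\<mu>\<close> and transition kernel \<open>K\<close>, given by the Ionescu-Tulcea theorem.
\<close>

definition chain_law :: "'x::countable pmf \<Rightarrow> ('x \<Rightarrow> 'x pmf) \<Rightarrow> (nat \<Rightarrow> 'x) measure" where
  "chain_law \<mu> K =
     projective_family.lim UNIV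
       (Ionescu_Tulcea.CI (chain_kernel \<mu> K) (\<lambda>_. count_space UNIV)) (\<lambda>_. count_space UNIV)"

definition step :: "('s \<Rightarrow> 'a \<Rightarrow> 's pmf) \<Rightarrow> ('s \<Rightarrow> 'a pmf) \<Rightarrow> 's \<times> 'a \<Rightarrow> ('s \<times> 'a) pmf" where
  "step P \<pi> = (\<lambda>(s, a). do { s' \<leftarrow> P s a; a' \<leftarrow> \<pi> s'; return_pmf (s', a') })"

definition discounted_return :: "('s \<Rightarrow> 'a \<Rightarrow> real) \<Rightarrow> real \<Rightarrow> (nat \<Rightarrow> 's \<times> 'a) \<Rightarrow> real" where
  "discounted_return r \<gamma> \<omega> = (\<Sum>t. \<gamma> ^ t * r (fst (\<omega> t)) (snd (\<omega> t)))"

definition V ::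
    "('s::finite \<Rightarrow> 'a::finite \<Rightarrow> 's pmf) \<Rightarrow> ('s \<Rightarrow> 'a \<Rightarrow> real) \<Rightarrow> real \<Rightarrow> ('s \<Rightarrow> 'a pmf) \<Rightarrow> 's \<Rightarrow> real"
  where
  "V P r \<gamma> \<pi> s =
     (\<integral>\<omega>. discounted_return r \<gamma> \<omega> \<partial>chain_law (do { a \<leftarrow> \<pi> s; return_pmf (s, a) }) (step P \<pi>))"

text \<open>
  Conditioning on \<open>(s\<^sub>0, a\<^sub>0) = (s, a)\<close> means starting the chain in \<open>(s, a)\<close>; this also covers
  actions to which the policy gives probability zero.
\<close>

definition Q ::
    "('s::finite \<Rightarrow> 'a::finite \<Rightarrow> 's pmf) \<Rightarrow> ('s \<Rightarrow> 'a \<Rightarrow> real) \<Rightarrow> real \<Rightarrow> ('s \<Rightarrow> 'a pmf) \<Rightarrow>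
      's \<Rightarrow> 'a \<Rightarrow> real"
  where
  "Q P r \<gamma> \<pi> s a = (\<integral>\<omega>. discounted_return r \<gamma> \<omega> \<partial>chain_law (return_pmf (s, a)) (step P \<pi>))"

text \<open>
  For rewards in \<open>[0, 1]\<close> and a discount in \<open>[0, 1)\<close> the two suprema below are over nonempty sets
  bounded by \<open>1 / (1 - \<gamma>)\<close>, and they are attained, so they are the maxima over all policies.
\<close>

definition V_star ::
    "('s::finite \<Rightarrow> 'a::finite \<Rightarrow> 's pmf) \<Rightarrow> ('s \<Rightarrow> 'a \<Rightarrow> real) \<Rightarrow> real \<Rightarrow> 's \<Rightarrow> real" where
  "V_star P r \<gamma> s = (SUP \<pi>. V P r \<gamma> \<pi> s)"

definition Q_star ::
    "('s::finite \<Rightarrow> 'a::finite \<Rightarrow> 's pmf) \<Rightarrow> ('s \<Rightarrow> 'a \<Rightarrow> real) \<Rightarrow> real \<Rightarrow> 's \<Rightarrow> 'a \<Rightarrow> real" where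
  "Q_star P r \<gamma> s a = (SUP \<pi>. Q P r \<gamma> \<pi> s a)"

definition optimal_policies ::
    "('s::finite \<Rightarrow> 'a::finite \<Rightarrow> 's pmf) \<Rightarrow> ('s \<Rightarrow> 'a \<Rightarrow> real) \<Rightarrow> real \<Rightarrow> ('s \<Rightarrow> 'a pmf) set" where
  "optimal_policies P r \<gamma> = {\<pi>. V P r \<gamma> \<pi> = V_star P r \<gamma>}"

definition optimal_actions ::
    "('s::finite \<Rightarrow> 'a::finite \<Rightarrow> 's pmf) \<Rightarrow> ('s \<Rightarrow> 'a \<Rightarrow> real) \<Rightarrow> real \<Rightarrow> 's \<Rightarrow> 'a set" where
  "optimal_actions P r \<gamma> s = {a. Q_star P r \<gamma> s a = V_star P r \<gamma> s}"


section \<open>Mirror maps and Bregman divergence\<close>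

definition effective_domain :: "(real \<Rightarrow> ereal) \<Rightarrow> real set" where
  "effective_domain \<psi> = {x. \<psi> x < \<infinity>}"

definition ereal_epigraph :: "(real \<Rightarrow> ereal) \<Rightarrow> (real \<times> real) set" where
  "ereal_epigraph \<psi> = {(x, t). \<psi> x \<le> ereal t}"

text \<open>Only meaningful on the interior of the effective domain, where \<open>\<psi>\<close> is finite.\<close>

definition ereal_deriv :: "(real \<Rightarrow> ereal) \<Rightarrow> real \<Rightarrow> real" where
  "ereal_deriv \<psi> = deriv (\<lambda>x. real_of_ereal (\<psi> x))"

definition mirror_map :: "(real \<Rightarrow> ereal) \<Rightarrow> bool" where
  "mirror_map \<psi> \<longleftrightarrow>
     {0..1} \<subseteq> effective_domain \<psi> \<and>
     (\<forall>x. \<psi> x \<noteq> -\<infinity>) \<and> effective_domain \<psi> \<noteq> {} \<and>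
     closed (ereal_epigraph \<psi>) \<and> convex (ereal_epigraph \<psi>) \<and>
     (\<forall>x\<in>interior (effective_domain \<psi>). (\<lambda>x. real_of_ereal (\<psi> x)) differentiable (at x)) \<and>
     (\<forall>X b. (\<forall>n. X n \<in> interior (effective_domain \<psi>)) \<and> b \<in> frontier (effective_domain \<psi>) \<and>
        X \<longlonglongrightarrow> b \<longrightarrow> filterlim (\<lambda>n. \<bar>ereal_deriv \<psi> (X n)\<bar>) at_top sequentially) \<and>
     (\<forall>x\<in>interior (effective_domain \<psi>). \<forall>y\<in>interior (effective_domain \<psi>). \<forall>t\<in>{0<..<1}.
        x \<noteq> y \<longrightarrow> \<psi> ((1 - t) * x + t * y) < ereal (1 - t) * \<psi> x + ereal t * \<psi> y)"

text \<open>
  The one-sided limits of \<open>\<psi>'\<close> at 0 and 1 are taken in the extended reals, where they exist because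
  \<open>\<psi>'\<close> is monotone on \<open>(0, 1)\<close>.
\<close>

definition deriv_0_plus :: "(real \<Rightarrow> ereal) \<Rightarrow> ereal" where
  "deriv_0_plus \<psi> = Lim (at_right 0) (\<lambda>x. ereal (ereal_deriv \<psi> x))"

definition deriv_1_minus :: "(real \<Rightarrow> ereal) \<Rightarrow> ereal" where
  "deriv_1_minus \<psi> = Lim (at_left 1) (\<lambda>x. ereal (ereal_deriv \<psi> x))"

definition separable :: "(real \<Rightarrow> ereal) \<Rightarrow> ('a::finite \<Rightarrow> real) \<Rightarrow> ereal" where
  "separable \<psi> p = (\<Sum>a\<in>UNIV. \<psi> (p a))"

text \<open>The gradient at \<open>q\<close>: the vector of partial derivatives.\<close>

definition grad :: "(('a::finite \<Rightarrow> real) \<Rightarrow> ereal) \<Rightarrow> ('a \<Rightarrow> real) \<Rightarrow> 'a \<Rightarrow> real" where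
  "grad h q a = deriv (\<lambda>x. real_of_ereal (h (q(a := x)))) (q a)"

definition bregman :: "(('a::finite \<Rightarrow> real) \<Rightarrow> ereal) \<Rightarrow> ('a \<Rightarrow> real) \<Rightarrow> ('a \<Rightarrow> real) \<Rightarrow> ereal" where
  "bregman h p q = h p - h q - ereal (\<Sum>a\<in>UNIV. grad h q a * (p a - q a))"


section \<open>Policy mirror descent\<close>

definition pmd_objective ::
    "('s::finite \<Rightarrow> 'a::finite \<Rightarrow> 's pmf) \<Rightarrow> ('s \<Rightarrow> 'a \<Rightarrow> real) \<Rightarrow> real \<Rightarrow> (real \<Rightarrow> ereal) \<Rightarrow> real \<Rightarrow>
      ('s \<Rightarrow> 'a pmf) \<Rightarrow> 's \<Rightarrow> 'a pmf \<Rightarrow> ereal"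
  where
  "pmd_objective P r \<gamma> \<psi> \<eta> \<pi> s p =
     ereal (\<eta> * (\<Sum>a\<in>UNIV. pmf p a * Q P r \<gamma> \<pi> s a)) - bregman (separable \<psi>) (pmf p) (pmf (\<pi> s))"

text \<open>
  The initial policy has to lie in the interior of the domain; that the later iterates do as well
  is a consequence and not part of the definition.
\<close>

definition pmd_sequence ::
    "('s::finite \<Rightarrow> 'a::finite \<Rightarrow> 's pmf) \<Rightarrow> ('s \<Rightarrow> 'a \<Rightarrow> real) \<Rightarrow> real \<Rightarrow> (real \<Rightarrow> ereal) \<Rightarrow> real \<Rightarrow>
      (nat \<Rightarrow> 's \<Rightarrow> 'a pmf) \<Rightarrow> bool"
  where
  "pmd_sequence P r \<gamma> \<psi> \<eta> \<pi> \<longleftrightarrow>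
     (\<forall>s a. pmf (\<pi> 0 s) a \<in> interior (effective_domain \<psi>)) \<and>
     (\<forall>k s. is_arg_max (pmd_objective P r \<gamma> \<psi> \<eta> (\<pi> k) s) (\<lambda>p. True) (\<pi> (Suc k) s))"

end

theory Submission
  imports Defs
begin

text \<open>
  Write \<open>Q\<^sub>k\<close> and \<open>V\<^sub>k\<close> for the value functions of the iterate \<open>\<pi>\<^sub>k\<close>, and
  \<open>B(p, q) = \<Sum>\<^sub>a \<psi>(p a) - \<psi>(q a) - \<psi>'(q a) (p a - q a)\<close>
  for the Bregman divergence of \<open>h\<close>.

  A finite limit of \<open>\<psi>'\<close> at 0 puts 0 inside the domain, by steepness at the boundary, while an infinite limit
  at 1 makes 1 its right endpoint. So a probability lies in the interior of the domain iff it is less than 1.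
  Because \<open>\<psi>'\<close> blows up at 1, no update puts mass 1 on an action (\<open>maximizer_lt_1\<close>); hence every iterate is
  a point of differentiability and satisfies a first-order optimality condition, which rearranges to the
  three-point inequality (\<open>three_point\<close>)
  \<open>\<eta> \<langle>p - \<pi>\<^sub>k\<^sub>+\<^sub>1, Q\<^sub>k\<rangle> \<le> B(p, \<pi>\<^sub>k) - B(p, \<pi>\<^sub>k\<^sub>+\<^sub>1) - B(\<pi>\<^sub>k\<^sub>+\<^sub>1, \<pi>\<^sub>k)\<close> for every distribution \<open>p\<close>.

  With \<open>p = \<pi>\<^sub>k\<close> it says that each step is a policy improvement. With an optimal \<open>p\<close> and policy improvement, the
  gap \<open>\<delta>\<^sub>k = V\<^sup>* - V\<^sub>k\<close> satisfies \<open>\<delta>\<^sub>k \<le> \<gamma> P\<^sup>* \<delta>\<^sub>k +\<close> (two telescoping terms). Summing over \<open>k\<close> and using that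
  \<open>\<gamma> P\<^sup>*\<close> is a contraction bounds \<open>\<Sum>\<^sub>k \<delta>\<^sub>k\<close> (\<open>summable_gap\<close>), so the errors \<open>Q\<^sup>* - Q\<^sub>k\<close> are summable even though
  the step size is constant.

  Summable errors make \<open>B(p, \<pi>\<^sub>k)\<close> almost decreasing for every \<open>p\<close> supported on optimal actions
  (\<open>quasi_fejer\<close>), with a decrease of order at least the mass of the nonoptimal actions. Hence \<open>B(p, \<pi>\<^sub>k)\<close> converges
  and the nonoptimal mass vanishes. If the optimal action is unique, this already is convergence. Otherwise let
  \<open>q\<close> be a limit point of the iterates. It is supported on optimal actions, and no \<open>q a\<close> equals 1: as
  \<open>\<pi>\<^sub>k a\<close> tends to 1 the divergence from the point mass at another optimal action tends to infinity, although
  it is bounded (\<open>limit_point_lt_1\<close>). So \<open>B(q, \<pi>\<^sub>k)\<close> tends to 0 along the subsequence, therefore along the whole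
  sequence, and strict convexity turns this into convergence to \<open>q\<close> (\<open>convergent_to_limit_point\<close>). A policy
  supported on optimal actions is optimal.
\<close>

section \<open>Finite distributions and almost decreasing sequences\<close>

lemma sum_pmf_UNIV: "(\<Sum>x\<in>UNIV. pmf p x) = 1" for p :: "'x::finite pmf"
  by (rule sum_pmf_eq_1) auto

lemma average_le:
  fixes p :: "'x::finite pmf"
  assumes "\<And>x. d x \<le> M"
  shows "(\<Sum>x\<in>UNIV. pmf p x * d x) \<le> M"
proof -
  have "(\<Sum>x\<in>UNIV. pmf p x * d x) \<le> (\<Sum>x\<in>UNIV. pmf p x * M)"
    by (intro sum_mono mult_left_mono assms) auto
  then show ?thesis
    by (simp add: sum_distrib_right[symmetric] sum_pmf_UNIV)
qed

lemma exists_pmf_with_weights: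
  fixes v :: "'x::finite \<Rightarrow> real"
  assumes "\<And>a. 0 \<le> v a" "(\<Sum>a\<in>UNIV. v a) = 1"
  shows "\<exists>p. \<forall>a. pmf p a = v a"
proof -
  have "(\<integral>\<^sup>+x. ennreal (v x) \<partial>count_space UNIV) = 1"
    using assms by (simp add: nn_integral_count_space_finite sum_ennreal)
  then show ?thesis using assms(1) by (auto intro!: exI[of _ "embed_pmf v"] pmf_embed_pmf)
qed

lemma expectation_bind_pmf_finite:
  fixes g :: "'y::finite \<Rightarrow> real" and p :: "'x::finite pmf"
  shows "measure_pmf.expectation (bind_pmf p K) g =
    (\<Sum>x\<in>UNIV. pmf p x * measure_pmf.expectation (K x) g)"
proof -
  have "measure_pmf.expectation (bind_pmf p K) g =
      (\<Sum>y\<in>UNIV. \<Sum>x\<in>UNIV. pmf p x * (pmf (K x) y * g y))"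
    by (subst integral_measure_pmf_real[where A = UNIV])
      (auto simp: pmf_bind integral_measure_pmf_real[where A = UNIV] sum_distrib_right
        sum_distrib_left mult_ac)
  also have "\<dots> = (\<Sum>x\<in>UNIV. pmf p x * measure_pmf.expectation (K x) g)"
    by (subst sum.swap)
      (auto simp: integral_measure_pmf_real[where A = UNIV] sum_distrib_left mult_ac)
  finally show ?thesis .
qed

text \<open>
  Adding the accumulated decrements and subtracting the accumulated errors turns \<open>d\<close> into a genuinely
  decreasing sequence.
\<close>

lemma almost_decreasing_convergent:
  fixes d m e :: "nat \<Rightarrow> real"
  assumes step: "\<And>k. d (Suc k) + m k \<le> d k + e k"
    and d: "\<And>k. 0 \<le> d k" and m: "\<And>k. 0 \<le> m k" and e: "\<And>k. 0 \<le> e k" "summable e"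
  shows "convergent d" and "summable m"
proof -
  define u where "u k = d k - (\<Sum>i<k. e i) + (\<Sum>i<k. m i)" for k
  have u_dec: "decseq u"
    unfolding decseq_Suc_iff
  proof
    show "u (Suc k) \<le> u k" for k using step[of k] by (simp add: u_def)
  qed
  have e_le: "(\<Sum>i<k. e i) \<le> suminf e" for k
    by (rule sum_le_suminf[OF e(2)]) (use e(1) in auto)
  have "(\<Sum>i<k. m i) \<le> d 0 + suminf e" for k
    using decseqD[OF u_dec, of 0 k] e_le[of k] d[of k] by (simp add: u_def)
  then show sm: "summable m" by (rule summableI_nonneg_bounded[OF m])
  have "- suminf e \<le> u k" for k
  proof -
    have "0 \<le> (\<Sum>i<k. m i)" by (rule sum_nonneg) (rule m)
    then show ?thesis using d[of k] e_le[of k] unfolding u_def by linarith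
  qed
  then have u: "convergent u"
    using decseq_convergent[OF u_dec] convergentI by metis
  have "convergent (\<lambda>k. u k + (\<Sum>i<k. e i) - (\<Sum>i<k. m i))"
    by (rule convergent_diff[OF convergent_add[OF u e(2)[unfolded summable_iff_convergent]]
          sm[unfolded summable_iff_convergent]])
  then show "convergent d" by (simp add: u_def)
qed

section \<open>Bellman equations\<close>

text \<open>
  The kernel is iterated on probability mass functions, so that expectations at a fixed time are finite sums when
  the state space is finite.
\<close>

primrec marginal :: "'x pmf \<Rightarrow> ('x \<Rightarrow> 'x pmf) \<Rightarrow> nat \<Rightarrow> 'x pmf" where
  "marginal \<mu> K 0 = \<mu>"
| "marginal \<mu> K (Suc t) = bind_pmf (marginal \<mu> K t) K"

lemma marginal_Suc_shift: "marginal \<mu> K (Suc t) = marginal (bind_pmf \<mu> K) K t"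
  by (induction t) auto

lemma marginal_bind: "marginal \<mu> K t = bind_pmf \<mu> (\<lambda>x. marginal (return_pmf x) K t)"
  by (induction t) (simp_all add: bind_return_pmf' bind_assoc_pmf)

text \<open>
  The path measure restricted to times up to \<open>t\<close> is an iterated kernel composition. Integrating out its last
  coordinate replaces a function of the present by its conditional expectation given the previous state, so an
  induction on \<open>t\<close> over all integrands identifies the law of each coordinate.
\<close>

lemma nn_integral_chain_law_coordinate:
  fixes \<mu> :: "'x::countable pmf" and f :: "'x \<Rightarrow> ennreal"
  shows "(\<integral>\<^sup>+\<omega>. f (\<omega> t) \<partial>chain_law \<mu> K) = (\<integral>\<^sup>+x. f x \<partial>measure_pmf (marginal \<mu> K t))"
proof -
  interpret IT: Ionescu_Tulcea "chain_kernel \<mu> K" "\<lambda>_. count_space UNIV :: 'x measure"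
    by (rule Ionescu_Tulcea_chain_kernel)
  let ?M = "\<lambda>_::nat. count_space UNIV :: 'x measure"
  let ?u = "\<lambda>_::nat. undefined :: 'x"
  have comp: "(\<lambda>\<omega>. g (\<omega> i)) \<in> borel_measurable (PiM I ?M)" if "i \<in> I" for i I and g :: "'x \<Rightarrow> ennreal"
    using measurable_component_singleton[OF that, of ?M] by (rule measurable_compose) simp
  have u: "?u \<in> space (PiM {0..<0} ?M)"
    by (simp add: space_PiM)
  have step: "(\<integral>\<^sup>+\<omega>. g (\<omega> n) \<partial>IT.C 0 (Suc n) ?u) =
      (\<integral>\<^sup>+\<omega>. (\<integral>\<^sup>+x. g x \<partial>chain_kernel \<mu> K n \<omega>) \<partial>IT.C 0 n ?u)" for n and g :: "'x \<Rightarrow> ennreal"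
  proof -
    have "(\<integral>\<^sup>+\<omega>. g (\<omega> n) \<partial>IT.C 0 (Suc n) ?u) =
        (\<integral>\<^sup>+\<omega>. (\<integral>\<^sup>+\<omega>'. g (\<omega>' n) \<partial>IT.eP n \<omega>) \<partial>IT.C 0 n ?u)"
      unfolding IT.C.simps add_0
      by (rule nn_integral_bind[where B = "PiM {0..<Suc n} ?M"])
        (use IT.measurable_eP[of n] u in
          \<open>auto intro!: comp simp: measurable_cong_sets[OF IT.sets_C[OF u] refl]\<close>)
    also have "\<dots> = (\<integral>\<^sup>+\<omega>. (\<integral>\<^sup>+x. g x \<partial>chain_kernel \<mu> K n \<omega>) \<partial>IT.C 0 n ?u)"
      by (rule nn_integral_cong)
        (use IT.space_C[OF u, of n] in \<open>auto simp: IT.nn_integral_eP comp\<close>)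
    finally show ?thesis .
  qed
  have C: "(\<integral>\<^sup>+\<omega>. g (\<omega> n) \<partial>IT.C 0 (Suc n) ?u) = (\<integral>\<^sup>+x. g x \<partial>measure_pmf (marginal \<mu> K n))"
    for n and g :: "'x \<Rightarrow> ennreal"
  proof (induction n arbitrary: g)
    case 0
    show ?case
      unfolding step
      using prob_space.emeasure_space_1[OF IT.prob_space_C[OF u, of 0]]
      by (simp add: chain_kernel_def del: IT.C.simps)
  next
    case (Suc n)
    have kernel: "chain_kernel \<mu> K (Suc n) \<omega> = measure_pmf (K (\<omega> n))" for \<omega>
      by (simp add: chain_kernel_def)
    show ?case
      unfolding step[of "Suc n" g]
      using Suc[of "\<lambda>x. \<integral>\<^sup>+y. g y \<partial>measure_pmf (K x)"]
      by (simp add: kernel nn_integral_bind_pmf del: IT.C.simps)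
  qed
  have up: "IT.up_to {t} = Suc t"
    unfolding IT.up_to_def by (rule Least_equality) (auto simp: Suc_le_eq not_less_eq_eq)
  have "(\<integral>\<^sup>+\<omega>. f (\<omega> t) \<partial>chain_law \<mu> K) =
      (\<integral>\<^sup>+\<omega>. f (\<omega> t) \<partial>distr IT.PF.lim (PiM {t} ?M) (\<lambda>x. restrict x {t}))"
    unfolding chain_law_def
    by (subst nn_integral_distr)
      (auto intro!: comp measurable_restrict_subset simp: measurable_cong_sets[OF IT.PF.sets_lim refl])
  also have "\<dots> = (\<integral>\<^sup>+\<omega>. f (\<omega> t) \<partial>IT.CI {t})"
    by (subst IT.distr_lim) auto
  also have "\<dots> = (\<integral>\<^sup>+\<omega>. f (\<omega> t) \<partial>IT.C 0 (Suc t) ?u)"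
    unfolding IT.CI_def up
    by (subst nn_integral_distr)
      (auto intro!: comp measurable_restrict_subset simp: measurable_cong_sets[OF IT.sets_C[OF u] refl]
        simp del: IT.C.simps)
  finally show ?thesis
    unfolding C .
qed

lemma measurable_coordinate_chain_law:
  "(\<lambda>\<omega>. \<omega> t) \<in> measurable (chain_law \<mu> K) (count_space UNIV)"
proof -
  interpret IT: Ionescu_Tulcea "chain_kernel \<mu> K" "\<lambda>_. count_space UNIV :: 'a measure"
    by (rule Ionescu_Tulcea_chain_kernel)
  show ?thesis
    unfolding chain_law_def measurable_cong_sets[OF IT.PF.sets_lim refl]
    by (rule measurable_component_singleton) simp
qed

lemma distr_chain_law_coordinate:
  "distr (chain_law \<mu> K) (count_space UNIV) (\<lambda>\<omega>. \<omega> t) = measure_pmf (marginal \<mu> K t)"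
proof (rule measure_eqI)
  fix A :: "'a set"
  have "emeasure (distr (chain_law \<mu> K) (count_space UNIV) (\<lambda>\<omega>. \<omega> t)) A =
      (\<integral>\<^sup>+x. indicator A x \<partial>distr (chain_law \<mu> K) (count_space UNIV) (\<lambda>\<omega>. \<omega> t))"
    by simp
  also have "\<dots> = (\<integral>\<^sup>+\<omega>. indicator A (\<omega> t) \<partial>chain_law \<mu> K)"
    by (rule nn_integral_distr[OF measurable_coordinate_chain_law]) simp
  also have "\<dots> = emeasure (measure_pmf (marginal \<mu> K t)) A"
    by (simp add: nn_integral_chain_law_coordinate)
  finally show "emeasure (distr (chain_law \<mu> K) (count_space UNIV) (\<lambda>\<omega>. \<omega> t)) A =
      emeasure (measure_pmf (marginal \<mu> K t)) A" .
qed simp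

lemma prob_space_chain_law: "prob_space (chain_law \<mu> K)"
  using prob_space_distrD[OF measurable_coordinate_chain_law[of 0 \<mu> K]]
  by (simp add: distr_chain_law_coordinate measure_pmf.prob_space_axioms)

text \<open>
  On a finite state space the reward is bounded, so the geometric weights dominate and the expectation may
  be taken termwise. This reduces integrals over paths to the marginal laws.
\<close>

lemma discounted_sum_chain_law:
  fixes \<rho> :: "'x::finite \<Rightarrow> real"
  assumes \<gamma>: "\<gamma> \<in> {0..<1}"
  shows "(\<integral>\<omega>. (\<Sum>t. \<gamma> ^ t * \<rho> (\<omega> t)) \<partial>chain_law \<mu> K) =
      (\<Sum>t. \<gamma> ^ t * measure_pmf.expectation (marginal \<mu> K t) \<rho>)"
    and "summable (\<lambda>t. \<gamma> ^ t * measure_pmf.expectation (marginal \<mu> K t) \<rho>)"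
proof -
  interpret prob_space "chain_law \<mu> K" by (rule prob_space_chain_law)
  define B where "B = (\<Sum>x\<in>UNIV. \<bar>\<rho> x\<bar>)"
  have B: "\<bar>\<rho> x\<bar> \<le> B" for x
    unfolding B_def by (rule member_le_sum) auto
  have meas: "(\<lambda>\<omega>. g (\<omega> t)) \<in> borel_measurable (chain_law \<mu> K)" for t and g :: "'x \<Rightarrow> real"
    using measurable_coordinate_chain_law by (rule measurable_compose) simp
  have E: "(\<integral>\<omega>. g (\<omega> t) \<partial>chain_law \<mu> K) = measure_pmf.expectation (marginal \<mu> K t) g"
    for t and g :: "'x \<Rightarrow> real"
    unfolding distr_chain_law_coordinate[symmetric]
    by (rule integral_distr[OF measurable_coordinate_chain_law, symmetric]) simp
  have int: "integrable (chain_law \<mu> K) (\<lambda>\<omega>. \<gamma> ^ t * \<rho> (\<omega> t))" for t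
    by (intro integrable_mult_right integrable_const_bound[where B = B] meas) (auto simp: B)
  have geo: "summable (\<lambda>t. \<gamma> ^ t * B)"
    using \<gamma> by (intro summable_mult2 summable_geometric) auto
  have absE: "\<bar>measure_pmf.expectation p g\<bar> \<le> B" if "\<And>x. \<bar>g x\<bar> \<le> B" for p :: "'x pmf" and g
  proof -
    have "\<bar>measure_pmf.expectation p g\<bar> \<le> measure_pmf.expectation p (\<lambda>x. \<bar>g x\<bar>)"
      by (rule integral_abs_bound)
    also have "\<dots> \<le> measure_pmf.expectation p (\<lambda>_. B)"
      using that by (intro integral_mono integrable_measure_pmf_finite) auto
    finally show ?thesis by simp
  qed
  have "(\<integral>\<omega>. (\<Sum>t. \<gamma> ^ t * \<rho> (\<omega> t)) \<partial>chain_law \<mu> K) =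
      (\<Sum>t. (\<integral>\<omega>. \<gamma> ^ t * \<rho> (\<omega> t) \<partial>chain_law \<mu> K))"
  proof (rule integral_suminf[OF int])
    show "AE \<omega> in chain_law \<mu> K. summable (\<lambda>t. norm (\<gamma> ^ t * \<rho> (\<omega> t)))"
      using \<gamma> B
      by (intro always_eventually allI summable_comparison_test'[OF geo])
        (auto simp: abs_mult intro!: mult_left_mono)
    show "summable (\<lambda>t. \<integral>\<omega>. norm (\<gamma> ^ t * \<rho> (\<omega> t)) \<partial>chain_law \<mu> K)"
      using \<gamma> B absE[of "\<lambda>x. \<bar>\<rho> x\<bar>"]
      by (intro summable_comparison_test'[OF geo])
        (auto simp: abs_mult E[of "\<lambda>x. \<bar>\<rho> x\<bar>"] intro!: mult_left_mono)
  qed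
  then show "(\<integral>\<omega>. (\<Sum>t. \<gamma> ^ t * \<rho> (\<omega> t)) \<partial>chain_law \<mu> K) =
      (\<Sum>t. \<gamma> ^ t * measure_pmf.expectation (marginal \<mu> K t) \<rho>)"
    by (simp add: E)
  show "summable (\<lambda>t. \<gamma> ^ t * measure_pmf.expectation (marginal \<mu> K t) \<rho>)"
    using \<gamma> absE[OF B]
    by (intro summable_comparison_test'[OF geo]) (auto simp: abs_mult intro!: mult_left_mono)
qed

text \<open>
  Marginal laws are linear in the initial distribution, hence so is the expected return. Both Bellman
  equations follow: one by averaging over the first action, the other by splitting off the first reward.
\<close>

lemma return_from_distribution:
  fixes P :: "'s::finite \<Rightarrow> 'a::finite \<Rightarrow> 's pmf" and \<mu> :: "('s \<times> 'a) pmf"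
  assumes \<gamma>: "\<gamma> \<in> {0..<1}"
  shows "(\<integral>\<omega>. discounted_return r \<gamma> \<omega> \<partial>chain_law \<mu> (step P \<pi>)) =
    (\<Sum>x\<in>UNIV. pmf \<mu> x * Q P r \<gamma> \<pi> (fst x) (snd x))"
proof -
  let ?\<rho> = "\<lambda>x. r (fst x) (snd x)"
  let ?E = "\<lambda>\<mu> t. measure_pmf.expectation (marginal \<mu> (step P \<pi>) t) ?\<rho>"
  note sums = discounted_sum_chain_law[OF \<gamma>, where \<rho> = ?\<rho> and K = "step P \<pi>"]
  have "(\<integral>\<omega>. discounted_return r \<gamma> \<omega> \<partial>chain_law \<mu> (step P \<pi>)) = (\<Sum>t. \<gamma> ^ t * ?E \<mu> t)"
    unfolding discounted_return_def by (rule sums(1))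
  also have "\<dots> = (\<Sum>t. \<Sum>x\<in>UNIV. pmf \<mu> x * (\<gamma> ^ t * ?E (return_pmf x) t))"
    by (subst marginal_bind) (simp add: expectation_bind_pmf_finite sum_distrib_left mult_ac)
  also have "\<dots> = (\<Sum>x\<in>UNIV. \<Sum>t. pmf \<mu> x * (\<gamma> ^ t * ?E (return_pmf x) t))"
    by (intro suminf_sum summable_mult sums(2))
  also have "\<dots> = (\<Sum>x\<in>UNIV. pmf \<mu> x * (\<Sum>t. \<gamma> ^ t * ?E (return_pmf x) t))"
    by (intro sum.cong refl suminf_mult sums(2))
  also have "\<dots> = (\<Sum>x\<in>UNIV. pmf \<mu> x * Q P r \<gamma> \<pi> (fst x) (snd x))"
    by (simp add: Q_def discounted_return_def sums(1))
  finally show ?thesis .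
qed

lemma V_eq_sum_Q:
  fixes P :: "'s::finite \<Rightarrow> 'a::finite \<Rightarrow> 's pmf"
  assumes \<gamma>: "\<gamma> \<in> {0..<1}"
  shows "V P r \<gamma> \<pi> s = (\<Sum>a\<in>UNIV. pmf (\<pi> s) a * Q P r \<gamma> \<pi> s a)"
proof -
  have "V P r \<gamma> \<pi> s = measure_pmf.expectation (do { a \<leftarrow> \<pi> s; return_pmf (s, a) })
      (\<lambda>x. Q P r \<gamma> \<pi> (fst x) (snd x))"
    unfolding V_def return_from_distribution[OF \<gamma>]
    by (simp add: integral_measure_pmf_real[where A = UNIV] mult_ac)
  then show ?thesis
    by (simp add: expectation_bind_pmf_finite)
qed

lemma Q_bellman:
  fixes P :: "'s::finite \<Rightarrow> 'a::finite \<Rightarrow> 's pmf"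
  assumes \<gamma>: "\<gamma> \<in> {0..<1}"
  shows "Q P r \<gamma> \<pi> s a = r s a + \<gamma> * (\<Sum>s'\<in>UNIV. pmf (P s a) s' * V P r \<gamma> \<pi> s')"
proof -
  let ?\<rho> = "\<lambda>x. r (fst x) (snd x)"
  let ?E = "\<lambda>\<mu> t. measure_pmf.expectation (marginal \<mu> (step P \<pi>) t) ?\<rho>"
  let ?\<nu> = "step P \<pi> (s, a)"
  note sums = discounted_sum_chain_law[OF \<gamma>, where \<rho> = ?\<rho> and K = "step P \<pi>"]
  have "Q P r \<gamma> \<pi> s a = (\<Sum>t. \<gamma> ^ t * ?E (return_pmf (s, a)) t)"
    unfolding Q_def discounted_return_def by (rule sums(1))
  also have "\<dots> = r s a + (\<Sum>t. \<gamma> ^ Suc t * ?E (return_pmf (s, a)) (Suc t))"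
    using suminf_split_head[OF sums(2)[of "return_pmf (s, a)"]] by simp
  also have "(\<Sum>t. \<gamma> ^ Suc t * ?E (return_pmf (s, a)) (Suc t)) = (\<Sum>t. \<gamma> * (\<gamma> ^ t * ?E ?\<nu> t))"
    unfolding marginal_Suc_shift by (simp add: bind_return_pmf mult_ac)
  also have "\<dots> = \<gamma> * (\<Sum>t. \<gamma> ^ t * ?E ?\<nu> t)"
    by (intro suminf_mult sums(2))
  also have "(\<Sum>t. \<gamma> ^ t * ?E ?\<nu> t) = (\<integral>\<omega>. discounted_return r \<gamma> \<omega> \<partial>chain_law ?\<nu> (step P \<pi>))"
    unfolding discounted_return_def by (rule sums(1)[symmetric])
  also have "\<dots> = measure_pmf.expectation ?\<nu> (\<lambda>x. Q P r \<gamma> \<pi> (fst x) (snd x))"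
    unfolding return_from_distribution[OF \<gamma>]
    by (simp add: integral_measure_pmf_real[where A = UNIV] mult_ac)
  also have "\<dots> = (\<Sum>s'\<in>UNIV. pmf (P s a) s' * V P r \<gamma> \<pi> s')"
    by (simp add: step_def expectation_bind_pmf_finite V_eq_sum_Q[OF \<gamma>])
  finally show ?thesis .
qed

section \<open>Optimal value functions\<close>

text \<open>
  From here on only the Bellman equations matter: values are treated as vectors, policies as monotone
  affine operators on them.
\<close>

locale discounted_mdp =
  fixes P :: "'s::finite \<Rightarrow> 'a::finite \<Rightarrow> 's pmf" and r :: "'s \<Rightarrow> 'a \<Rightarrow> real" and \<gamma> :: real
  assumes discount: "\<gamma> \<in> {0..<1}"
begin

definition lookahead :: "('s \<Rightarrow> real) \<Rightarrow> 's \<Rightarrow> 'a \<Rightarrow> real" where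
  "lookahead v s a = r s a + \<gamma> * (\<Sum>s'\<in>UNIV. pmf (P s a) s' * v s')"

definition backup :: "('s \<Rightarrow> 'a pmf) \<Rightarrow> ('s \<Rightarrow> real) \<Rightarrow> 's \<Rightarrow> real" where
  "backup \<pi> v s = (\<Sum>a\<in>UNIV. pmf (\<pi> s) a * lookahead v s a)"

text \<open>
  The linear part of \<open>backup \<pi>\<close>, that is the matrix \<open>\<gamma> P\<^sub>\<pi>\<close>.
\<close>

definition discounted_next :: "('s \<Rightarrow> 'a pmf) \<Rightarrow> ('s \<Rightarrow> real) \<Rightarrow> 's \<Rightarrow> real" where
  "discounted_next \<pi> d s = (\<Sum>a\<in>UNIV. pmf (\<pi> s) a * (\<gamma> * (\<Sum>s'\<in>UNIV. pmf (P s a) s' * d s')))"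

lemma Q_lookahead: "Q P r \<gamma> \<pi> s a = lookahead (V P r \<gamma> \<pi>) s a"
  unfolding lookahead_def by (rule Q_bellman[OF discount])

lemma V_backup: "backup \<pi> (V P r \<gamma> \<pi>) s = V P r \<gamma> \<pi> s"
  unfolding backup_def V_eq_sum_Q[OF discount, of P r \<pi> s] Q_lookahead ..

lemma lookahead_diff:
  "lookahead v s a - lookahead w s a = \<gamma> * (\<Sum>s'\<in>UNIV. pmf (P s a) s' * (v s' - w s'))"
  by (simp add: lookahead_def right_diff_distrib sum_subtractf)

lemma backup_diff: "backup \<pi> v s - backup \<pi> w s = discounted_next \<pi> (\<lambda>s. v s - w s) s"
  unfolding backup_def discounted_next_def lookahead_diff[symmetric]
  by (simp add: right_diff_distrib sum_subtractf)

lemma lookahead_mono: "(\<And>s. v s \<le> w s) \<Longrightarrow> lookahead v s a \<le> lookahead w s a"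
  unfolding lookahead_def using discount
  by (intro add_left_mono mult_left_mono sum_mono) auto

lemma backup_mono: "(\<And>s. v s \<le> w s) \<Longrightarrow> backup \<pi> v s \<le> backup \<pi> w s"
  unfolding backup_def by (intro sum_mono mult_left_mono lookahead_mono) auto

lemma discounted_next_le: "(\<And>s. d s \<le> M) \<Longrightarrow> discounted_next \<pi> d s \<le> \<gamma> * M"
  unfolding discounted_next_def using discount
  by (intro average_le mult_left_mono) auto

lemma discounted_next_sum:
  "discounted_next \<pi> (\<lambda>s. \<Sum>i\<in>A. d i s) s = (\<Sum>i\<in>A. discounted_next \<pi> (d i) s)"
proof -
  have "discounted_next \<pi> (\<lambda>s. \<Sum>i\<in>A. d i s) s =
      (\<Sum>a\<in>UNIV. \<Sum>i\<in>A. pmf (\<pi> s) a * (\<gamma> * (\<Sum>s'\<in>UNIV. pmf (P s a) s' * d i s')))"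
    unfolding discounted_next_def by (simp add: sum_distrib_left sum.swap[of _ A])
  then show ?thesis
    unfolding discounted_next_def by (simp add: sum.swap[of _ A])
qed

text \<open>
  A maximum principle: evaluate the hypothesis where \<open>d\<close> is largest; there the discounted
  average of \<open>d\<close> is at most \<open>\<gamma>\<close> times its value. It stands in for the contraction argument, and in particular gives
  the comparison of subsolutions and supersolutions of a backup with its fixed point \<open>V\<close>.
\<close>

lemma le_of_le_discounted_next:
  assumes "\<And>s. d s \<le> c + discounted_next \<pi> d s"
  shows "d s \<le> c / (1 - \<gamma>)"
proof -
  define M where "M = Max (range d)"
  have M: "d s \<le> M" for s unfolding M_def by simp
  have "M \<in> range d" unfolding M_def by (rule Max_in) auto
  then obtain s0 where s0: "d s0 = M" by auto
  have "M \<le> c + \<gamma> * M"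
    using assms[of s0] discounted_next_le[of d M \<pi> s0, OF M] s0 by linarith
  then have "M \<le> c / (1 - \<gamma>)"
    using discount by (simp add: field_simps)
  with M[of s] show ?thesis by linarith
qed

lemma nonpos_of_le_discounted_next:
  "(\<And>s. d s \<le> discounted_next \<pi> d s) \<Longrightarrow> d s \<le> 0"
  using le_of_le_discounted_next[of d 0 \<pi> s] by simp

lemma V_le_of_backup_le:
  assumes "\<And>s. backup \<pi> v s \<le> v s"
  shows "V P r \<gamma> \<pi> s \<le> v s"
proof -
  have "V P r \<gamma> \<pi> s - v s \<le> 0"
  proof (rule nonpos_of_le_discounted_next)
    show "V P r \<gamma> \<pi> s - v s \<le> discounted_next \<pi> (\<lambda>s. V P r \<gamma> \<pi> s - v s) s" for s
      unfolding backup_diff[symmetric] V_backup using assms[of s] by simp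
  qed
  then show ?thesis by simp
qed

lemma le_V_of_le_backup:
  assumes "\<And>s. v s \<le> backup \<pi> v s"
  shows "v s \<le> V P r \<gamma> \<pi> s"
proof -
  have "v s - V P r \<gamma> \<pi> s \<le> 0"
  proof (rule nonpos_of_le_discounted_next)
    show "v s - V P r \<gamma> \<pi> s \<le> discounted_next \<pi> (\<lambda>s. v s - V P r \<gamma> \<pi> s) s" for s
      unfolding backup_diff[symmetric] V_backup using assms[of s] by simp
  qed
  then show ?thesis by simp
qed

text \<open>
  If a backup by \<open>\<pi>'\<close> does not decrease the value of \<open>\<pi>\<close>, then that value is a subsolution for \<open>\<pi>'\<close>; one
  further backup of the comparison gives the quantitative form.
\<close>

lemma policy_improvement:
  assumes "\<And>s. V P r \<gamma> \<pi> s \<le> backup \<pi>' (V P r \<gamma> \<pi>) s"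
  shows "backup \<pi>' (V P r \<gamma> \<pi>) s \<le> V P r \<gamma> \<pi>' s"
  using backup_mono[of "V P r \<gamma> \<pi>" "V P r \<gamma> \<pi>'" \<pi>' s, OF le_V_of_le_backup[OF assms]] by (simp add: V_backup)

lemma backup_return: "backup (\<lambda>s. return_pmf (f s)) v s = lookahead v s (f s)"
proof -
  have "backup (\<lambda>s. return_pmf (f s)) v s = (\<Sum>a\<in>UNIV. if a = f s then lookahead v s a else 0)"
    unfolding backup_def by (intro sum.cong) (auto simp: pmf_return)
  then show ?thesis by simp
qed

text \<open>
  Among the finitely many deterministic policies take one of largest total value. Its greedy improvement is again
  deterministic and at least as good in every state, so it has the same value; hence no action has a larger
  lookahead than the value itself.
\<close>

lemma exists_deterministic_bellman_solution:
  "\<exists>f. \<forall>s a. lookahead (V P r \<gamma> (\<lambda>s. return_pmf (f s))) s a \<le> V P r \<gamma> (\<lambda>s. return_pmf (f s)) s"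
proof -
  let ?W = "\<lambda>f. V P r \<gamma> (\<lambda>s. return_pmf (f s))"
  define tot where "tot f = (\<Sum>s\<in>UNIV. ?W f s)" for f
  have "Max (range tot) \<in> range tot" by (rule Max_in) auto
  then obtain f where f: "tot f = Max (range tot)" by (metis imageE)
  have f_max: "tot f' \<le> tot f" for f' unfolding f by simp
  have "\<exists>a. \<forall>b. lookahead (?W f) s b \<le> lookahead (?W f) s a" for s
  proof -
    have "Max (range (lookahead (?W f) s)) \<in> range (lookahead (?W f) s)" by (rule Max_in) auto
    then obtain a where "lookahead (?W f) s a = Max (range (lookahead (?W f) s))" by (metis imageE)
    then show ?thesis by (intro exI[of _ a]) auto
  qed
  then obtain f' where f': "\<And>s b. lookahead (?W f) s b \<le> lookahead (?W f) s (f' s)" by metis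
  have le: "?W f s \<le> backup (\<lambda>s. return_pmf (f' s)) (?W f) s" for s
    using f'[of s "f s"] V_backup[of "\<lambda>s. return_pmf (f s)" s] by (simp add: backup_return)
  note imp = policy_improvement[OF le]
  have "?W f' s = ?W f s" for s
  proof (rule ccontr)
    assume "?W f' s \<noteq> ?W f s"
    then have "?W f s < ?W f' s" using le[of s] imp[of s] by linarith
    moreover have "?W f s \<le> ?W f' s" for s using le[of s] imp[of s] by linarith
    ultimately have "tot f < tot f'" unfolding tot_def by (intro sum_strict_mono_ex1) auto
    with f_max[of f'] show False by simp
  qed
  then have "lookahead (?W f) s a \<le> ?W f s" for s a
    using f'[of s a] imp[of s] by (simp add: backup_return)
  then show ?thesis by blast
qed

text \<open>
  The value of the policy found above is a supersolution for every policy, so it dominates all values and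
  realizes the suprema defining \<open>V_star\<close> and \<open>Q_star\<close> simultaneously.
\<close>

lemma bellman_optimality:
  shows V_le_V_star: "V P r \<gamma> \<pi> s \<le> V_star P r \<gamma> s"
    and Q_star_lookahead: "Q_star P r \<gamma> s a = lookahead (V_star P r \<gamma>) s a"
    and Q_star_le_V_star: "Q_star P r \<gamma> s a \<le> V_star P r \<gamma> s"
    and optimal_actions_nonempty: "optimal_actions P r \<gamma> s \<noteq> {}"
proof -
  obtain f where f: "\<And>s a. lookahead (V P r \<gamma> (\<lambda>s. return_pmf (f s))) s a \<le> V P r \<gamma> (\<lambda>s. return_pmf (f s)) s"
    using exists_deterministic_bellman_solution by blast
  define \<pi>f where "\<pi>f = (\<lambda>s. return_pmf (f s))"
  have "backup \<pi> (V P r \<gamma> \<pi>f) s \<le> V P r \<gamma> \<pi>f s" for \<pi> s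
    unfolding backup_def using f by (intro average_le) (simp add: \<pi>f_def)
  then have V_le: "V P r \<gamma> \<pi> s \<le> V P r \<gamma> \<pi>f s" for \<pi> s
    by (rule V_le_of_backup_le)
  have Vs: "V_star P r \<gamma> s = V P r \<gamma> \<pi>f s" for s
    unfolding V_star_def using V_le by (intro cSup_eq_maximum) auto
  have Qs: "Q_star P r \<gamma> s a = lookahead (V P r \<gamma> \<pi>f) s a" for s a
    unfolding Q_star_def Q_lookahead
    using V_le by (intro cSup_eq_maximum) (auto intro!: lookahead_mono)
  show "V P r \<gamma> \<pi> s \<le> V_star P r \<gamma> s" by (simp add: Vs V_le)
  have "V_star P r \<gamma> = V P r \<gamma> \<pi>f" by (simp add: Vs fun_eq_iff)
  then show "Q_star P r \<gamma> s a = lookahead (V_star P r \<gamma>) s a" by (simp add: Qs)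
  show "Q_star P r \<gamma> s a \<le> V_star P r \<gamma> s" by (simp add: Qs Vs \<pi>f_def f)
  have "f s \<in> optimal_actions P r \<gamma> s"
    using V_backup[of \<pi>f s] by (simp add: optimal_actions_def Qs Vs \<pi>f_def backup_return)
  then show "optimal_actions P r \<gamma> s \<noteq> {}" by auto
qed

lemma Q_le_Q_star: "Q P r \<gamma> \<pi> s a \<le> Q_star P r \<gamma> s a"
  unfolding Q_lookahead Q_star_lookahead by (intro lookahead_mono V_le_V_star)

lemma Q_star_eq_V_star: "a \<in> optimal_actions P r \<gamma> s \<Longrightarrow> Q_star P r \<gamma> s a = V_star P r \<gamma> s"
  by (simp add: optimal_actions_def)

lemma average_Q_star:
  assumes "\<And>a. a \<notin> optimal_actions P r \<gamma> s \<Longrightarrow> pmf p a = 0"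
  shows "(\<Sum>a\<in>UNIV. pmf p a * Q_star P r \<gamma> s a) = V_star P r \<gamma> s"
proof -
  have "(\<Sum>a\<in>UNIV. pmf p a * Q_star P r \<gamma> s a) = (\<Sum>a\<in>UNIV. pmf p a * V_star P r \<gamma> s)"
    using assms Q_star_eq_V_star by (intro sum.cong) (simp, metis mult_cancel_left)
  then show ?thesis by (simp add: sum_distrib_right[symmetric] sum_pmf_UNIV)
qed

text \<open>
  Choosing only optimal actions makes \<open>V_star\<close> a fixed point of the backup, and the fixed point is unique.
\<close>

lemma optimal_if_supported:
  assumes supp: "\<And>s a. a \<notin> optimal_actions P r \<gamma> s \<Longrightarrow> pmf (\<pi> s) a = 0"
  shows "\<pi> \<in> optimal_policies P r \<gamma>"
proof -
  have "backup \<pi> (V_star P r \<gamma>) s = V_star P r \<gamma> s" for s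
    unfolding backup_def Q_star_lookahead[symmetric] using supp by (rule average_Q_star)
  then have "V_star P r \<gamma> s \<le> V P r \<gamma> \<pi> s" for s
    by (intro le_V_of_le_backup) simp
  then show ?thesis
    using V_le_V_star by (auto simp: optimal_policies_def fun_eq_iff intro: antisym)
qed

end

section \<open>Mirror maps that are steep at 1\<close>

text \<open>
  The two conditions on \<open>\<psi>'\<close> determine how the domain meets the unit interval: 0 is an interior point and 1 is
  an endpoint.
\<close>

locale steep_mirror_map =
  fixes \<psi> :: "real \<Rightarrow> ereal"
  assumes mirror: "mirror_map \<psi>"
    and deriv_0: "deriv_0_plus \<psi> > -\<infinity>"
    and deriv_1: "deriv_1_minus \<psi> = \<infinity>"
begin

text \<open>
  The real-valued version of \<open>\<psi>\<close> allows real convex analysis; it is faithful on the domain, which contains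
  every point used below.
\<close>

definition f :: "real \<Rightarrow> real" where "f x = real_of_ereal (\<psi> x)"

abbreviation g :: "real \<Rightarrow> real" where "g \<equiv> ereal_deriv \<psi>"
abbreviation D :: "real set" where "D \<equiv> effective_domain \<psi>"

lemma unit_interval_in_domain: "{0..1} \<subseteq> D"
  and not_minus_infinity: "\<psi> x \<noteq> -\<infinity>"
  and convex_epigraph: "convex (ereal_epigraph \<psi>)"
  using mirror by (auto simp: mirror_map_def)

lemma psi_eq: "x \<in> D \<Longrightarrow> \<psi> x = ereal (f x)"
  using not_minus_infinity[of x] by (auto simp: f_def effective_domain_def ereal_real)

lemma convex_combination:
  assumes "x \<in> D" "y \<in> D" "u \<ge> 0" "v \<ge> 0" "u + v = 1"
  shows "u * x + v * y \<in> D" and "f (u * x + v * y) \<le> u * f x + v * f y"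
proof -
  have "(x, f x) \<in> ereal_epigraph \<psi>" "(y, f y) \<in> ereal_epigraph \<psi>"
    using assms by (auto simp: ereal_epigraph_def psi_eq)
  from convexD[OF convex_epigraph this assms(3-5)]
  have le: "\<psi> (u * x + v * y) \<le> ereal (u * f x + v * f y)"
    by (simp add: ereal_epigraph_def)
  then show "u * x + v * y \<in> D" by (auto simp: effective_domain_def)
  from psi_eq[OF this] le show "f (u * x + v * y) \<le> u * f x + v * f y" by simp
qed

lemma convex_domain: "convex D"
  unfolding convex_def using convex_combination(1) by auto

lemma convex_on_f: "convex_on D f"
  using convex_domain convex_combination(2) by (intro convex_onI) (auto simp: convex_on_def)

lemma f_has_derivative: "x \<in> interior D \<Longrightarrow> (f has_real_derivative g x) (at x)"
  using mirror unfolding mirror_map_def ereal_deriv_def f_def[abs_def]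
  by (auto simp: DERIV_deriv_iff_real_differentiable)

lemma above_tangent:
  assumes "x \<in> interior D" "y \<in> D"
  shows "g x * (y - x) \<le> f y - f x"
  using convex_on_imp_above_tangent[OF convex_on_f _ assms(1) assms(2)]
    f_has_derivative[OF assms(1)] convex_connected[OF convex_domain]
  by (simp add: has_field_derivative_at_within)

text \<open>
  Strict convexity enters only here: compare the chord and the tangent at the midpoint.
\<close>

lemma strictly_above_tangent:
  assumes "x \<in> interior D" "y \<in> interior D" "x \<noteq> y"
  shows "g x * (y - x) < f y - f x"
proof -
  have D: "x \<in> D" "y \<in> D" using assms interior_subset by auto
  let ?m = "(1 - 1/2) * x + (1/2) * y :: real"
  have m: "?m \<in> D" using convex_combination(1)[OF D, of "1/2" "1/2"] by simp
  have "\<psi> ?m < ereal (1 - 1/2) * \<psi> x + ereal (1/2) * \<psi> y"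
  proof -
    have *: "\<forall>x\<in>interior D. \<forall>y\<in>interior D. \<forall>t\<in>{0<..<1}.
        x \<noteq> y \<longrightarrow> \<psi> ((1 - t) * x + t * y) < ereal (1 - t) * \<psi> x + ereal t * \<psi> y"
      using mirror unfolding mirror_map_def by blast
    have "(1/2::real) \<in> {0<..<1}" by simp
    with * assms show ?thesis by blast
  qed
  then have "f ?m < (f x + f y) / 2"
    unfolding psi_eq[OF m] psi_eq[OF D(1)] psi_eq[OF D(2)] by simp
  moreover have "g x * (?m - x) \<le> f ?m - f x"
    by (rule above_tangent[OF assms(1) m])
  moreover have "g x * (?m - x) = g x * (y - x) / 2" by (simp add: field_simps)
  ultimately show ?thesis by argo
qed

lemma g_mono:
  assumes "x \<in> interior D" "y \<in> interior D" "x \<le> y"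
  shows "g x \<le> g y"
proof (cases "x = y")
  case False
  have D: "x \<in> D" "y \<in> D" using assms interior_subset by auto
  have "g x * (y - x) \<le> f y - f x" "g y * (x - y) \<le> f x - f y"
    using above_tangent assms D by auto
  then have "g x * (y - x) \<le> g y * (y - x)" by (simp add: algebra_simps)
  with False assms show ?thesis by simp
qed simp

lemma open_unit_interval: "{0<..<1} \<subseteq> interior D"
  using interior_mono[OF unit_interval_in_domain] by simp

text \<open>
  The one-sided limits exist by monotonicity, as a supremum and an infimum. This identifies the values of
  \<open>Lim\<close> in the definitions of \<open>deriv_1_minus\<close> and \<open>deriv_0_plus\<close>.
\<close>

lemma tendsto_g_at_left_1: "((\<lambda>x. ereal (g x)) \<longlongrightarrow> (SUP x\<in>{0<..<1}. ereal (g x))) (at_left 1)"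
proof (rule order_tendstoI)
  fix l assume "l < (SUP x\<in>{0<..<1}. ereal (g x))"
  then obtain x where x: "x \<in> {0<..<1}" "l < ereal (g x)" by (auto simp: less_SUP_iff)
  have "eventually (\<lambda>y. y \<in> {x<..<1}) (at_left 1)"
    using x by (intro eventually_at_leftI[of x]) auto
  then show "eventually (\<lambda>y. l < ereal (g y)) (at_left 1)"
  proof eventually_elim
    case (elim y)
    have "g x \<le> g y" using x elim open_unit_interval by (intro g_mono) auto
    with x show ?case by (metis ereal_less_eq(3) less_le_trans)
  qed
next
  fix u assume u: "(SUP x\<in>{0<..<1}. ereal (g x)) < u"
  have "eventually (\<lambda>y. y \<in> {0<..<1}) (at_left (1::real))"
    by (intro eventually_at_leftI[of 0]) auto
  then show "eventually (\<lambda>y. ereal (g y) < u) (at_left 1)"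
    by eventually_elim (metis SUP_upper u le_less_trans)
qed

lemma tendsto_g_at_right_0: "((\<lambda>x. ereal (g x)) \<longlongrightarrow> (INF x\<in>{0<..<1}. ereal (g x))) (at_right 0)"
proof (rule order_tendstoI)
  fix u assume "(INF x\<in>{0<..<1}. ereal (g x)) < u"
  then obtain x where x: "x \<in> {0<..<1}" "ereal (g x) < u" by (auto simp: INF_less_iff)
  have "eventually (\<lambda>y. y \<in> {0<..<x}) (at_right 0)"
    using x by (intro eventually_at_rightI[of _ x]) auto
  then show "eventually (\<lambda>y. ereal (g y) < u) (at_right 0)"
  proof eventually_elim
    case (elim y)
    have "g y \<le> g x" using x elim open_unit_interval by (intro g_mono) auto
    with x show ?case by (metis ereal_less_eq(3) le_less_trans)
  qed
next
  fix l assume l: "l < (INF x\<in>{0<..<1}. ereal (g x))"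
  have "eventually (\<lambda>y. y \<in> {0<..<1}) (at_right (0::real))"
    by (intro eventually_at_rightI[of _ 1]) auto
  then show "eventually (\<lambda>y. l < ereal (g y)) (at_right 0)"
    by eventually_elim (metis INF_lower l less_le_trans)
qed

lemma g_unbounded_at_1: "\<exists>x\<in>{0<..<1}. B < g x"
proof -
  have "(SUP x\<in>{0<..<1}. ereal (g x)) = \<infinity>"
    using tendsto_Lim[OF _ tendsto_g_at_left_1] deriv_1 by (simp add: deriv_1_minus_def)
  then have "ereal B < (SUP x\<in>{0<..<1}. ereal (g x))" by simp
  then show ?thesis by (auto simp: less_SUP_iff)
qed

lemma g_bounded_below_at_0: "\<exists>B. \<forall>x\<in>{0<..<1}. B \<le> g x"
proof -
  have "(INF x\<in>{0<..<1}. ereal (g x)) > -\<infinity>"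
    using tendsto_Lim[OF _ tendsto_g_at_right_0] deriv_0 by (simp add: deriv_0_plus_def)
  then obtain B where "ereal B < (INF x\<in>{0<..<1}. ereal (g x))"
    using ereal_dense2 by blast
  then have "\<forall>x\<in>{0<..<1}. ereal B \<le> ereal (g x)"
    by (metis INF_lower less_imp_le order_trans)
  then show ?thesis by auto
qed

text \<open>
  If 0 were a boundary point, the derivative would be unbounded in absolute value along every interior sequence
  tending to 0; but near 0 it is bounded above by monotonicity and below by the finiteness of its limit.
\<close>

lemma zero_interior: "0 \<in> interior D"
proof (rule ccontr)
  assume "0 \<notin> interior D"
  moreover have "0 \<in> D" using unit_interval_in_domain by auto
  ultimately have 0: "0 \<in> frontier D" using closure_subset by (auto simp: frontier_def)
  let ?X = "\<lambda>n. 1 / real (n + 2)"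
  have X: "?X n \<in> {0<..<1}" for n by auto
  have to_0: "?X \<longlonglongrightarrow> 0"
    using LIMSEQ_ignore_initial_segment[OF lim_1_over_n, of 2] by simp
  have "filterlim (\<lambda>n. \<bar>g (?X n)\<bar>) at_top sequentially"
  proof -
    have "\<forall>X b. (\<forall>n. X n \<in> interior D) \<and> b \<in> frontier D \<and> X \<longlonglongrightarrow> b \<longrightarrow>
        filterlim (\<lambda>n. \<bar>g (X n)\<bar>) at_top sequentially"
      using mirror unfolding mirror_map_def by blast
    from this[rule_format, of ?X 0] to_0 X open_unit_interval 0 show ?thesis
      by blast
  qed
  moreover obtain B where B: "\<forall>x\<in>{0<..<1}. B \<le> g x" using g_bounded_below_at_0 by blast
  ultimately have "eventually (\<lambda>n. \<bar>B\<bar> + \<bar>g (1/2)\<bar> < \<bar>g (?X n)\<bar>) sequentially"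
    by (simp add: filterlim_at_top_dense)
  then obtain n where n: "\<bar>B\<bar> + \<bar>g (1/2)\<bar> < \<bar>g (?X n)\<bar>"
    by (auto simp: eventually_sequentially)
  have "g (?X n) \<le> g (1/2)"
    using X[of n] open_unit_interval by (intro g_mono) (auto simp: field_simps)
  with n B X[of n] show False by (smt (verit))
qed

lemma half_open_unit_interval: "{0..<1} \<subseteq> interior D"
proof
  fix x :: real assume "x \<in> {0..<1}"
  then show "x \<in> interior D"
    using zero_interior open_unit_interval by (cases "x = 0") auto
qed

lemma interior_domainI: "x \<in> {0..<1} \<Longrightarrow> x \<in> interior D"
  using half_open_unit_interval by blast

lemma domainI: "x \<in> {0..1} \<Longrightarrow> x \<in> D"
  using unit_interval_in_domain by blast

text \<open>
  By monotonicity the derivative at an interior point bounds the derivative to its left.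
\<close>

lemma one_not_interior: "1 \<notin> interior D"
proof
  assume "1 \<in> interior D"
  moreover obtain x where x: "x \<in> {0<..<1}" "g 1 < g x" using g_unbounded_at_1 by blast
  ultimately have "g x \<le> g 1" using open_unit_interval by (intro g_mono) auto
  with x show False by simp
qed

lemma interior_iff: "x \<in> {0..1} \<Longrightarrow> x \<in> interior D \<longleftrightarrow> x < 1"
  using half_open_unit_interval one_not_interior by (cases "x = 1") auto

definition breg :: "real \<Rightarrow> real \<Rightarrow> real" where
  "breg p x = f p - f x - g x * (p - x)"

lemma breg_nonneg: "p \<in> {0..1} \<Longrightarrow> x \<in> {0..<1} \<Longrightarrow> 0 \<le> breg p x"
  using above_tangent[OF interior_domainI domainI, of x p] by (simp add: breg_def)

lemma breg_pos: "p \<in> {0..<1} \<Longrightarrow> x \<in> {0..<1} \<Longrightarrow> x \<noteq> p \<Longrightarrow> 0 < breg p x"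
  using strictly_above_tangent[OF interior_domainI interior_domainI, of x p] by (simp add: breg_def)

text \<open>
  The divergence from \<open>p\<close> increases as its second argument moves away from \<open>p\<close>. This replaces the continuity
  of \<open>\<psi>'\<close> in recovering convergence of points from convergence of divergences.
\<close>

lemma breg_mono_away:
  assumes "p \<in> {0..<1}" "x \<in> {0..<1}" "y \<in> {0..<1}" "p \<le> y \<and> y \<le> x \<or> x \<le> y \<and> y \<le> p"
  shows "breg p y \<le> breg p x"
proof -
  have "0 \<le> breg y x" using assms by (intro breg_nonneg) auto
  moreover have "0 \<le> (g x - g y) * (y - p)"
    using assms(4)
  proof
    assume "p \<le> y \<and> y \<le> x"
    then show ?thesis
      using g_mono[OF interior_domainI interior_domainI, of y x] assms by (intro mult_nonneg_nonneg) auto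
  next
    assume "x \<le> y \<and> y \<le> p"
    then show ?thesis
      using g_mono[OF interior_domainI interior_domainI, of x y] assms by (intro mult_nonpos_nonpos) auto
  qed
  moreover have "breg p x - breg p y = breg y x + (g x - g y) * (y - p)"
    by (simp add: breg_def algebra_simps)
  ultimately show ?thesis by linarith
qed

text \<open>
  By monotonicity, points at distance at least \<open>e\<close> from \<open>q\<close> have divergence at least its value at
  \<open>q + e\<close> or \<open>q - e\<close>, which is positive by strict convexity.
\<close>

lemma tendsto_of_breg_tendsto_0:
  assumes q: "q \<in> {0..<1}" and x: "\<And>n. x n \<in> {0..<1}"
    and lim: "(\<lambda>n. breg q (x n)) \<longlonglongrightarrow> 0"
  shows "x \<longlonglongrightarrow> q"
proof (rule LIMSEQ_I)
  fix e :: real assume e: "0 < e"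
  \<comment> \<open>If \<open>q + e\<close> or \<open>q - e\<close> leaves \<open>[0, 1)\<close>, no point lies on that side and any positive value will do.\<close>
  define hi where "hi = (if q + e < 1 then breg q (q + e) else 1)"
  define lo where "lo = (if 0 \<le> q - e then breg q (q - e) else 1)"
  have "0 < hi" "0 < lo"
    unfolding hi_def lo_def using q e by (auto intro!: breg_pos)
  then have ev: "eventually (\<lambda>n. breg q (x n) < min hi lo) sequentially"
    by (intro order_tendstoD(2)[OF lim]) simp
  have "\<bar>x n - q\<bar> < e" if "breg q (x n) < min hi lo" for n
  proof (rule ccontr)
    assume "\<not> \<bar>x n - q\<bar> < e"
    then consider "q + e \<le> x n" | "x n \<le> q - e" by linarith
    then show False
    proof cases
      case 1
      then have "breg q (q + e) \<le> breg q (x n)" "q + e < 1"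
        using q x[of n] e by (auto intro!: breg_mono_away)
      with that show False by (simp add: hi_def)
    next
      case 2
      then have "breg q (q - e) \<le> breg q (x n)" "0 \<le> q - e"
        using q x[of n] e by (auto intro!: breg_mono_away)
      with that show False by (simp add: lo_def)
    qed
  qed
  with ev show "\<exists>no. \<forall>n\<ge>no. norm (x n - q) < e"
    unfolding eventually_sequentially by auto
qed

text \<open>
  Away from 1 the derivative is bounded, so the first-order term vanishes with the distance.
\<close>

lemma breg_tendsto_0:
  assumes q: "q \<in> {0..<1}" and x: "\<And>n. x n \<in> {0..<1}" and lim: "x \<longlonglongrightarrow> q"
  shows "(\<lambda>n. breg q (x n)) \<longlonglongrightarrow> 0"
proof -
  define y where "y = (q + 1) / 2"
  have y: "q < y" "y \<in> {0..<1}" using q by (auto simp: y_def)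
  have "(\<lambda>n. f (x n)) \<longlonglongrightarrow> f q"
    using DERIV_isCont[OF f_has_derivative[OF interior_domainI[OF q]]] lim
    by (rule isCont_tendsto_compose)
  moreover have "(\<lambda>n. g (x n) * (q - x n)) \<longlonglongrightarrow> 0"
  proof (rule Lim_null_comparison)
    show "(\<lambda>n. (\<bar>g 0\<bar> + \<bar>g y\<bar>) * \<bar>q - x n\<bar>) \<longlonglongrightarrow> 0"
      using tendsto_mult_right_zero[OF tendsto_rabs_zero[OF LIM_zero[OF lim]]]
      by (simp add: abs_minus_commute)
    have "eventually (\<lambda>n. x n < y) sequentially" using order_tendstoD(2)[OF lim y(1)] .
    then show "eventually (\<lambda>n. norm (g (x n) * (q - x n)) \<le> (\<bar>g 0\<bar> + \<bar>g y\<bar>) * \<bar>q - x n\<bar>) sequentially"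
    proof eventually_elim
      case (elim n)
      have "g 0 \<le> g (x n)" "g (x n) \<le> g y"
        using x[of n] y elim by (auto intro!: g_mono interior_domainI)
      then have "\<bar>g (x n)\<bar> \<le> \<bar>g 0\<bar> + \<bar>g y\<bar>" by linarith
      then show ?case by (auto simp: abs_mult intro!: mult_right_mono)
    qed
  qed
  ultimately have "(\<lambda>n. f q - f (x n) - g (x n) * (q - x n)) \<longlonglongrightarrow> f q - f q - 0"
    by (intro tendsto_intros)
  then show ?thesis by (simp add: breg_def)
qed

text \<open>
  As \<open>x\<close> tends to 1, the term \<open>g x * x\<close> of the divergence from 0 tends to infinity while \<open>f x\<close> stays bounded.
\<close>

lemma breg_0_bounded_away_from_1:
  assumes x: "\<And>n. x n \<in> {0..<1}" and bound: "\<And>n. breg 0 (x n) \<le> B"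
  shows "\<not> x \<longlonglongrightarrow> 1"
proof
  assume lim: "x \<longlonglongrightarrow> 1"
  \<comment> \<open>The factor 2 compensates for \<open>x n\<close> being only known to exceed 1/2.\<close>
  define C where "C = 2 * (\<bar>B\<bar> + \<bar>f 1\<bar> + 2 * \<bar>f 0\<bar>)"
  obtain y where y: "y \<in> {0<..<1}" "C < g y" using g_unbounded_at_1 by blast
  have "eventually (\<lambda>n. max y (1/2) < x n) sequentially"
    using y by (intro order_tendstoD(1)[OF lim]) auto
  then obtain n where n: "max y (1/2) < x n" by (auto simp: eventually_sequentially)
  have "g y \<le> g (x n)" using x[of n] y n by (intro g_mono interior_domainI) auto
  then have "C * (1/2) < g (x n) * x n"
    using y n by (intro mult_strict_mono') (auto simp: C_def)
  moreover have "f (x n) \<le> \<bar>f 0\<bar> + \<bar>f 1\<bar>"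
  proof -
    have "f ((1 - x n) * 0 + x n * 1) \<le> (1 - x n) * f 0 + x n * f 1"
      using unit_interval_in_domain x[of n] by (intro convex_combination(2)) auto
    also have "\<dots> \<le> \<bar>(1 - x n) * f 0\<bar> + \<bar>x n * f 1\<bar>"
      by linarith
    also have "\<dots> \<le> \<bar>f 0\<bar> + \<bar>f 1\<bar>"
      using x[of n] by (intro add_mono) (auto simp: abs_mult intro!: mult_left_le_one_le)
    finally show ?thesis by simp
  qed
  ultimately show False using bound[of n] by (simp add: breg_def C_def)
qed

subsection \<open>Separable divergence and simplex maximizers\<close>

definition divergence :: "'x::finite pmf \<Rightarrow> 'x pmf \<Rightarrow> real" where
  "divergence p q = (\<Sum>a\<in>UNIV. breg (pmf p a) (pmf q a))"

lemma separable_eq: "(\<And>a. x a \<in> D) \<Longrightarrow> separable \<psi> x = ereal (\<Sum>a\<in>UNIV. f (x a))"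
  by (simp add: separable_def psi_eq)

text \<open>
  Changing one coordinate changes one summand, and the value stays finite near an interior point, so the partial
  derivative may be computed with the real-valued sum.
\<close>

lemma grad_separable:
  fixes q :: "'x::finite \<Rightarrow> real"
  assumes q: "\<And>a. q a \<in> interior D"
  shows "grad (separable \<psi>) q a = g (q a)"
proof -
  let ?h = "\<lambda>x. f x + (\<Sum>b\<in>UNIV - {a}. f (q b))"
  have "((\<lambda>x. real_of_ereal (separable \<psi> (q(a := x)))) has_real_derivative g (q a)) (at (q a))"
  proof (rule has_field_derivative_transform_within_open)
    show "(?h has_real_derivative g (q a)) (at (q a))"
      using f_has_derivative[OF q[of a]] by (auto intro!: derivative_eq_intros)
    show "open (interior D)" "q a \<in> interior D" using q by auto
    fix x assume x: "x \<in> interior D"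
    have "separable \<psi> (q(a := x)) = ereal (\<Sum>b\<in>UNIV. f ((q(a := x)) b))"
      using x q interior_subset[of D] by (intro separable_eq) auto
    also have "(\<Sum>b\<in>UNIV. f ((q(a := x)) b)) = ?h x"
      by (subst sum.remove[of UNIV a]) (auto intro!: sum.cong)
    finally show "?h x = real_of_ereal (separable \<psi> (q(a := x)))" by (simp only: real_of_ereal.simps)
  qed
  then show ?thesis unfolding grad_def by (rule DERIV_imp_deriv)
qed

lemma pmf_unit: "pmf p a \<in> {0..1}"
  by (simp add: pmf_le_1)

lemma bregman_separable:
  fixes p q :: "'x::finite pmf"
  assumes q: "\<And>a. pmf q a < 1"
  shows "bregman (separable \<psi>) (pmf p) (pmf q) = ereal (divergence p q)"
proof -
  have qi: "pmf q a \<in> interior D" for a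
    using q by (intro interior_domainI) auto
  have "separable \<psi> (pmf p) = ereal (\<Sum>a\<in>UNIV. f (pmf p a))" for p :: "'x pmf"
    by (intro separable_eq domainI pmf_unit)
  then show ?thesis
    unfolding bregman_def divergence_def breg_def
    by (simp add: grad_separable[OF qi] sum_subtractf)
qed

lemma divergence_nonneg: "(\<And>a. pmf q a < 1) \<Longrightarrow> 0 \<le> divergence p q"
  unfolding divergence_def by (intro sum_nonneg breg_nonneg pmf_unit) auto

lemma breg_le_divergence: "(\<And>a. pmf q a < 1) \<Longrightarrow> breg (pmf p a) (pmf q a) \<le> divergence p q"
  unfolding divergence_def by (intro member_le_sum breg_nonneg pmf_unit) auto

lemma divergence_self: "divergence p p = 0"
  by (simp add: divergence_def breg_def)

text \<open>
  Suppose all mass sits at \<open>a\<close>, and move mass \<open>t\<close> to another action \<open>b\<close>. By convexity this gains at least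
  \<open>g (1 - t) * t\<close> at \<open>a\<close>, while the other terms lose at most a constant times \<open>t\<close>, since the derivative is
  bounded above near 0. As \<open>g (1 - t)\<close> is unbounded, the move is profitable for small \<open>t\<close>.
\<close>

lemma maximizer_lt_1:
  fixes x :: "'x::finite pmf"
  assumes max: "\<And>p. (\<Sum>i\<in>UNIV. c i * pmf p i - f (pmf p i)) \<le> (\<Sum>i\<in>UNIV. c i * pmf x i - f (pmf x i))"
    and b: "b \<noteq> a"
  shows "pmf x a < 1"
proof (rule ccontr)
  assume "\<not> pmf x a < 1"
  then have a1: "pmf x a = 1" using pmf_le_1[of x a] by linarith
  have others: "pmf x i = 0" if "i \<noteq> a" for i
  proof -
    have "pmf x a + pmf x i = (\<Sum>j\<in>{a, i}. pmf x j)" using that by simp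
    also have "\<dots> \<le> (\<Sum>j\<in>UNIV. pmf x j)" by (intro sum_mono2) auto
    also have "\<dots> = 1" by (rule sum_pmf_eq_1) auto
    finally show ?thesis using a1 pmf_nonneg[of x i] by linarith
  qed
  let ?F = "\<lambda>i y. c i * y - f y"
  have split: "(\<Sum>i\<in>UNIV. h i) = h a + h b + (\<Sum>i\<in>UNIV - {a} - {b}. h i)" for h :: "'x \<Rightarrow> real"
    using b by (simp add: sum.remove[of UNIV a] sum.remove[of "UNIV - {a}" b])
  have bound: "g (1 - t) \<le> c a - c b + g (1/2)" if t: "0 < t" "t \<le> 1/2" for t
  proof -
    let ?v = "\<lambda>i. if i = a then 1 - t else if i = b then t else 0"
    have "\<exists>p. \<forall>i. pmf p i = ?v i"
      using b t by (intro exists_pmf_with_weights) (auto simp: split)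
    then obtain p where p: "\<And>i. pmf p i = ?v i" by blast
    have "?F a (1 - t) + ?F b t + (\<Sum>i\<in>UNIV - {a} - {b}. ?F i 0) \<le>
        ?F a 1 + ?F b 0 + (\<Sum>i\<in>UNIV - {a} - {b}. ?F i 0)"
      using max[of p] b by (simp add: split p others a1)
    then have "f 1 - f (1 - t) \<le> (c a - c b) * t + (f t - f 0)"
      by (simp add: algebra_simps)
    moreover have "g (1 - t) * t \<le> f 1 - f (1 - t)"
      using above_tangent[OF interior_domainI domainI, of "1 - t" 1] t by simp
    moreover have "f t - f 0 \<le> g t * t"
      using above_tangent[OF interior_domainI domainI, of t 0] t by simp
    moreover have "g t * t \<le> g (1/2) * t"
      using t by (intro mult_right_mono g_mono interior_domainI) auto
    ultimately have "g (1 - t) * t \<le> (c a - c b + g (1/2)) * t"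
      by (simp add: algebra_simps)
    with t show ?thesis by simp
  qed
  obtain y where y: "y \<in> {0<..<1}" "c a - c b + g (1/2) < g y"
    using g_unbounded_at_1 by blast
  define z where "z = max y (1/2)"
  have z: "y \<le> z" "1/2 \<le> z" "z < 1" using y by (auto simp: z_def)
  have "g y \<le> g z" using y z by (intro g_mono interior_domainI) auto
  moreover have "g z \<le> c a - c b + g (1/2)" using bound[of "1 - z"] z by simp
  ultimately show False using y by simp
qed

text \<open>
  First-order optimality along the segment from \<open>x\<close> to \<open>p\<close>. All coordinates of \<open>x\<close> are interior points, so the
  objective has a two-sided derivative there, even though only small positive parameters are feasible.
\<close>

lemma maximizer_variational_inequality:
  fixes x p :: "'x::finite pmf"
  assumes max: "\<And>p. (\<Sum>i\<in>UNIV. c i * pmf p i - f (pmf p i)) \<le> (\<Sum>i\<in>UNIV. c i * pmf x i - f (pmf x i))"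
    and x: "\<And>a. pmf x a < 1"
  shows "(\<Sum>i\<in>UNIV. (c i - g (pmf x i)) * (pmf p i - pmf x i)) \<le> 0"
proof (rule ccontr)
  let ?y = "\<lambda>t i. pmf x i + t * (pmf p i - pmf x i)"
  let ?F = "\<lambda>t. \<Sum>i\<in>UNIV. c i * ?y t i - f (?y t i)"
  assume "\<not> ?thesis"
  then have pos: "0 < (\<Sum>i\<in>UNIV. (c i - g (pmf x i)) * (pmf p i - pmf x i))" by simp
  have "((\<lambda>t. f (?y t i)) has_real_derivative g (pmf x i) * (pmf p i - pmf x i)) (at 0)" for i
  proof (rule DERIV_chain2[where g = "\<lambda>t. ?y t i"])
    show "(f has_real_derivative g (pmf x i)) (at (?y 0 i))"
      using x[of i] by (auto intro!: f_has_derivative interior_domainI)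
    show "((\<lambda>t. ?y t i) has_real_derivative pmf p i - pmf x i) (at 0)"
      by (auto intro!: derivative_eq_intros)
  qed
  then have "(?F has_real_derivative (\<Sum>i\<in>UNIV. (c i - g (pmf x i)) * (pmf p i - pmf x i))) (at 0)"
    by (auto intro!: derivative_eq_intros sum.cong simp: algebra_simps)
  from DERIV_pos_inc_right[OF this pos]
  obtain d where d: "d > 0" "\<And>h. 0 < h \<Longrightarrow> h < d \<Longrightarrow> ?F 0 < ?F h" by auto
  define h where "h = min (d / 2) 1"
  have h: "0 < h" "h < d" "h \<le> 1" using d(1) by (auto simp: h_def)
  have "\<exists>q. \<forall>i. pmf q i = ?y h i"
  proof (rule exists_pmf_with_weights)
    fix i
    have "?y h i = (1 - h) * pmf x i + h * pmf p i" by (simp add: algebra_simps)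
    then show "0 \<le> ?y h i" using h by simp
  next
    show "(\<Sum>i\<in>UNIV. ?y h i) = 1"
      by (simp add: sum.distrib sum_distrib_left[symmetric] sum_subtractf sum_pmf_eq_1)
  qed
  then obtain q where q: "\<And>i. pmf q i = ?y h i" by blast
  have "?F h \<le> ?F 0" using max[of q] by (simp add: q)
  with d(2)[OF h(1,2)] show False by simp
qed

end

section \<open>Policy mirror descent\<close>

locale pmd = discounted_mdp P r \<gamma> + steep_mirror_map \<psi>
  for P :: "'s::finite \<Rightarrow> 'a::finite \<Rightarrow> 's pmf" and r \<gamma> \<psi> +
  fixes \<eta> :: real and \<pi> :: "nat \<Rightarrow> 's \<Rightarrow> 'a pmf"
  assumes step_size: "\<eta> > 0" and pmd: "pmd_sequence P r \<gamma> \<psi> \<eta> \<pi>"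
begin

text \<open>
  The objective of the update is, up to a constant, a linear functional minus \<open>h\<close>: the gradient
  of \<open>h\<close> at the previous iterate is absorbed into the linear part.
\<close>

lemma update_maximizes:
  assumes lt: "\<And>a. pmf (\<pi> k s) a < 1"
  shows "(\<Sum>i\<in>UNIV. (\<eta> * Q P r \<gamma> (\<pi> k) s i + g (pmf (\<pi> k s) i)) * pmf p i - f (pmf p i)) \<le>
    (\<Sum>i\<in>UNIV. (\<eta> * Q P r \<gamma> (\<pi> k) s i + g (pmf (\<pi> k s) i)) * pmf (\<pi> (Suc k) s) i - f (pmf (\<pi> (Suc k) s) i))"
proof -
  let ?c = "\<lambda>i. \<eta> * Q P r \<gamma> (\<pi> k) s i + g (pmf (\<pi> k s) i)"
  let ?const = "\<Sum>i\<in>UNIV. f (pmf (\<pi> k s) i) - g (pmf (\<pi> k s) i) * pmf (\<pi> k s) i"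
  have obj: "pmd_objective P r \<gamma> \<psi> \<eta> (\<pi> k) s p =
      ereal ((\<Sum>i\<in>UNIV. ?c i * pmf p i - f (pmf p i)) + ?const)" for p
  proof -
    have "\<eta> * (\<Sum>a\<in>UNIV. pmf p a * Q P r \<gamma> (\<pi> k) s a) - divergence p (\<pi> k s) =
        (\<Sum>i\<in>UNIV. ?c i * pmf p i - f (pmf p i)) + ?const"
      unfolding divergence_def breg_def sum_distrib_left sum.distrib[symmetric] sum_subtractf[symmetric]
      by (intro sum.cong) (auto simp: algebra_simps)
    then show ?thesis by (simp add: pmd_objective_def bregman_separable[OF lt])
  qed
  have "\<not> pmd_objective P r \<gamma> \<psi> \<eta> (\<pi> k) s p > pmd_objective P r \<gamma> \<psi> \<eta> (\<pi> k) s (\<pi> (Suc k) s)"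
    using pmd by (auto simp: pmd_sequence_def is_arg_max_def)
  then show ?thesis by (simp add: obj)
qed

text \<open>
  The induction needs a second action; there is one because the previous iterate does not put mass 1 on \<open>a\<close>.
\<close>

lemma iterate_lt_1: "pmf (\<pi> k s) a < 1"
proof (induction k arbitrary: a)
  case 0
  have "pmf (\<pi> 0 s) a \<in> interior D" using pmd by (simp add: pmd_sequence_def)
  then show ?case by (simp only: interior_iff[OF pmf_unit])
next
  case (Suc k)
  have "\<exists>b. b \<noteq> a"
  proof (rule ccontr)
    assume "\<nexists>b. b \<noteq> a"
    then have "(\<Sum>b\<in>{a}. pmf (\<pi> k s) b) = 1" by (intro sum_pmf_eq_1) auto
    then have "pmf (\<pi> k s) a = 1" by simp
    with Suc[of a] show False by simp
  qed
  then obtain b where "b \<noteq> a" by blast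
  then show ?case by (rule maximizer_lt_1[OF update_maximizes[OF Suc]])
qed

text \<open>
  The three divergences differ by \<open>\<langle>\<nabla>h(\<pi>\<^sub>k\<^sub>+\<^sub>1) - \<nabla>h(\<pi>\<^sub>k), p - \<pi>\<^sub>k\<^sub>+\<^sub>1\<rangle>\<close>, so the claim is the
  variational inequality for the update.
\<close>

lemma three_point:
  "\<eta> * (\<Sum>a\<in>UNIV. (pmf p a - pmf (\<pi> (Suc k) s) a) * Q P r \<gamma> (\<pi> k) s a) \<le>
    divergence p (\<pi> k s) - divergence p (\<pi> (Suc k) s) - divergence (\<pi> (Suc k) s) (\<pi> k s)"
proof -
  have "\<eta> * (\<Sum>a\<in>UNIV. (pmf p a - pmf (\<pi> (Suc k) s) a) * Q P r \<gamma> (\<pi> k) s a) -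
      (divergence p (\<pi> k s) - divergence p (\<pi> (Suc k) s) - divergence (\<pi> (Suc k) s) (\<pi> k s)) =
      (\<Sum>i\<in>UNIV. (\<eta> * Q P r \<gamma> (\<pi> k) s i + g (pmf (\<pi> k s) i) - g (pmf (\<pi> (Suc k) s) i)) *
        (pmf p i - pmf (\<pi> (Suc k) s) i))"
    unfolding divergence_def breg_def sum_distrib_left sum.distrib[symmetric] sum_subtractf[symmetric]
    by (intro sum.cong) (auto simp: algebra_simps)
  also have "\<dots> \<le> 0"
    by (rule maximizer_variational_inequality[OF update_maximizes[OF iterate_lt_1] iterate_lt_1])
  finally show ?thesis by simp
qed

lemma three_point_le:
  "\<eta> * (\<Sum>a\<in>UNIV. (pmf p a - pmf (\<pi> (Suc k) s) a) * Q P r \<gamma> (\<pi> k) s a) \<le>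
    divergence p (\<pi> k s) - divergence p (\<pi> (Suc k) s)"
  using three_point[of p k s] divergence_nonneg[of "\<pi> k s" "\<pi> (Suc k) s", OF iterate_lt_1] by linarith

subsection \<open>The value gap is summable\<close>

lemma V_eq_backup_sum: "backup \<mu> (V P r \<gamma> \<nu>) s = (\<Sum>a\<in>UNIV. pmf (\<mu> s) a * Q P r \<gamma> \<nu> s a)"
  by (simp add: backup_def Q_lookahead)

text \<open>
  Take \<open>p = \<pi>\<^sub>k\<close> in the three-point inequality: the update does not decrease the expected \<open>Q\<close>-value.
\<close>

lemma backup_next_le_V: "backup (\<pi> (Suc k)) (V P r \<gamma> (\<pi> k)) s \<le> V P r \<gamma> (\<pi> (Suc k)) s"
proof (rule policy_improvement)
  fix s
  have "\<eta> * (\<Sum>a\<in>UNIV. (pmf (\<pi> k s) a - pmf (\<pi> (Suc k) s) a) * Q P r \<gamma> (\<pi> k) s a) \<le> 0"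
    using three_point_le[of "\<pi> k s" k s] divergence_nonneg[of "\<pi> (Suc k) s" "\<pi> k s", OF iterate_lt_1]
    by (simp add: divergence_self)
  then have "(\<Sum>a\<in>UNIV. (pmf (\<pi> k s) a - pmf (\<pi> (Suc k) s) a) * Q P r \<gamma> (\<pi> k) s a) \<le> 0"
    using step_size by (simp add: mult_le_0_iff)
  then show "V P r \<gamma> (\<pi> k) s \<le> backup (\<pi> (Suc k)) (V P r \<gamma> (\<pi> k)) s"
    unfolding V_eq_backup_sum by (simp add: left_diff_distrib sum_subtractf V_eq_sum_Q[OF discount])
qed

definition gap :: "nat \<Rightarrow> 's \<Rightarrow> real" where
  "gap k s = V_star P r \<gamma> s - V P r \<gamma> (\<pi> k) s"

lemma gap_nonneg: "0 \<le> gap k s"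
  using V_le_V_star by (simp add: gap_def)

text \<open>
  Split \<open>V\<^sup>* - V\<^sub>k\<close> into the difference of two backups by the optimal policy \<open>\<mu>\<close>, which is linear in the gap,
  and the advantage of \<open>\<mu>\<close> over \<open>\<pi>\<^sub>k\<close>. The latter is the advantage of \<open>\<mu>\<close> over \<open>\<pi>\<^sub>k\<^sub>+\<^sub>1\<close>, bounded by the
  three-point inequality, plus the advantage of \<open>\<pi>\<^sub>k\<^sub>+\<^sub>1\<close> over \<open>\<pi>\<^sub>k\<close>, bounded by the increase of the value.
\<close>

lemma gap_recursion:
  assumes supp: "\<And>s a. a \<notin> optimal_actions P r \<gamma> s \<Longrightarrow> pmf (\<mu> s) a = 0"
  shows "gap k s \<le> discounted_next \<mu> (gap k) s +
    (divergence (\<mu> s) (\<pi> k s) - divergence (\<mu> s) (\<pi> (Suc k) s)) / \<eta> + (gap k s - gap (Suc k) s)"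
proof -
  let ?V = "V P r \<gamma> (\<pi> k)"
  have "backup \<mu> (V_star P r \<gamma>) s = V_star P r \<gamma> s"
    unfolding backup_def Q_star_lookahead[symmetric] using supp by (rule average_Q_star)
  then have "gap k s = discounted_next \<mu> (gap k) s + (backup \<mu> ?V s - ?V s)"
    using backup_diff[of \<mu> "V_star P r \<gamma>" s ?V] by (simp add: gap_def[abs_def])
  moreover have "backup \<mu> ?V s - backup (\<pi> (Suc k)) ?V s \<le>
      (divergence (\<mu> s) (\<pi> k s) - divergence (\<mu> s) (\<pi> (Suc k) s)) / \<eta>"
    using three_point_le[of "\<mu> s" k s] step_size
    unfolding V_eq_backup_sum by (simp add: field_simps left_diff_distrib sum_subtractf)
  moreover have "backup (\<pi> (Suc k)) ?V s \<le> V P r \<gamma> (\<pi> (Suc k)) s"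
    by (rule backup_next_le_V)
  ultimately show ?thesis by (simp add: gap_def)
qed

text \<open>
  The recursion telescopes: the partial sums of the gap satisfy the hypothesis of the maximum principle with a
  constant independent of the number of terms.
\<close>

lemma summable_gap: "summable (\<lambda>k. gap k s)"
proof -
  have "\<forall>s. \<exists>a. a \<in> optimal_actions P r \<gamma> s" using optimal_actions_nonempty by blast
  then obtain b where b: "\<And>s. b s \<in> optimal_actions P r \<gamma> s" by metis
  let ?\<mu> = "\<lambda>s. return_pmf (b s)"
  have supp: "a \<notin> optimal_actions P r \<gamma> s \<Longrightarrow> pmf (?\<mu> s) a = 0" for s a
    using b[of s] by (auto simp: indicator_def)
  define C where "C = (\<Sum>s\<in>UNIV. divergence (?\<mu> s) (\<pi> 0 s) / \<eta> + gap 0 s)"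
  have C: "divergence (?\<mu> s) (\<pi> 0 s) / \<eta> + gap 0 s \<le> C" for s
    unfolding C_def using step_size
    by (intro member_le_sum[of s UNIV "\<lambda>s. divergence (?\<mu> s) (\<pi> 0 s) / \<eta> + gap 0 s"]
        add_nonneg_nonneg divide_nonneg_pos divergence_nonneg iterate_lt_1 gap_nonneg) auto
  have telescope: "(\<Sum>k<n. x k - x (Suc k)) = x 0 - x n" for n and x :: "nat \<Rightarrow> real"
    by (induction n) auto
  have "(\<Sum>k<n. gap k s) \<le> C / (1 - \<gamma>)" for n s
  proof (rule le_of_le_discounted_next[where \<pi> = ?\<mu>])
    fix s
    have "(\<Sum>k<n. gap k s) \<le> (\<Sum>k<n. discounted_next ?\<mu> (gap k) s +
        (divergence (?\<mu> s) (\<pi> k s) - divergence (?\<mu> s) (\<pi> (Suc k) s)) / \<eta> + (gap k s - gap (Suc k) s))"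
      by (intro sum_mono gap_recursion supp)
    also have "\<dots> = discounted_next ?\<mu> (\<lambda>s. \<Sum>k<n. gap k s) s +
        (divergence (?\<mu> s) (\<pi> 0 s) - divergence (?\<mu> s) (\<pi> n s)) / \<eta> + (gap 0 s - gap n s)"
      by (simp add: sum.distrib discounted_next_sum sum_divide_distrib[symmetric]
          telescope[of "\<lambda>k. divergence (?\<mu> s) (\<pi> k s)"] telescope[of "\<lambda>k. gap k s"])
    also have "\<dots> \<le> C + discounted_next ?\<mu> (\<lambda>s. \<Sum>k<n. gap k s) s"
    proof -
      have "0 \<le> divergence (?\<mu> s) (\<pi> n s) / \<eta>"
        using step_size by (intro divide_nonneg_pos divergence_nonneg iterate_lt_1)
      with C[of s] gap_nonneg[of n s] show ?thesis by (simp add: diff_divide_distrib)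
    qed
    finally show "(\<Sum>k<n. gap k s) \<le> C + discounted_next ?\<mu> (\<lambda>s. \<Sum>k<n. gap k s) s" .
  qed
  then show ?thesis by (intro summableI_nonneg_bounded gap_nonneg)
qed

subsection \<open>Convergence of the policies\<close>

definition Q_gap :: "nat \<Rightarrow> 's \<Rightarrow> real" where
  "Q_gap k s = (\<Sum>a\<in>UNIV. Q_star P r \<gamma> s a - Q P r \<gamma> (\<pi> k) s a)"

lemma summable_Q_gap: "summable (\<lambda>k. Q_gap k s)"
  unfolding Q_gap_def Q_lookahead Q_star_lookahead lookahead_diff gap_def[symmetric]
  by (intro summable_sum summable_mult summable_gap)

lemma Q_gap_nonneg: "0 \<le> Q_gap k s"
  unfolding Q_gap_def using Q_le_Q_star by (intro sum_nonneg) simp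

text \<open>
  The expected suboptimality of one action drawn from the iterate; it controls the mass of the
  nonoptimal actions.
\<close>

definition loss :: "nat \<Rightarrow> 's \<Rightarrow> real" where
  "loss k s = (\<Sum>a\<in>UNIV. pmf (\<pi> k s) a * (V_star P r \<gamma> s - Q_star P r \<gamma> s a))"

text \<open>
  In the three-point inequality replace \<open>Q\<^sub>k\<close> by \<open>Q\<^sup>*\<close>, at the cost of the error \<open>Q\<^sup>* - Q\<^sub>k\<close> weighted by \<open>p\<close>; the
  error weighted by the new iterate is nonnegative and has the favourable sign.
  Since \<open>p\<close> attains \<open>V\<^sup>*\<close>, the left-hand side becomes the loss of the new iterate.
\<close>

lemma quasi_fejer:
  assumes supp: "\<And>a. a \<notin> optimal_actions P r \<gamma> s \<Longrightarrow> pmf p a = 0"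
  shows "divergence p (\<pi> (Suc k) s) + \<eta> * loss (Suc k) s \<le> divergence p (\<pi> k s) + \<eta> * Q_gap k s"
proof -
  let ?Q = "Q P r \<gamma> (\<pi> k) s" and ?Qs = "Q_star P r \<gamma> s" and ?x = "pmf (\<pi> (Suc k) s)"
  have "(\<Sum>a\<in>UNIV. pmf p a * (?Qs a - ?Q a)) \<le> Q_gap k s"
    unfolding Q_gap_def using Q_le_Q_star
    by (intro sum_mono mult_left_le_one_le) (auto simp: pmf_le_1)
  moreover have "(\<Sum>a\<in>UNIV. pmf p a * ?Qs a) = V_star P r \<gamma> s"
    using supp by (rule average_Q_star)
  moreover have "(\<Sum>a\<in>UNIV. ?x a * ?Q a) \<le> (\<Sum>a\<in>UNIV. ?x a * ?Qs a)"
    using Q_le_Q_star by (intro sum_mono mult_left_mono) auto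
  moreover have "loss (Suc k) s = V_star P r \<gamma> s - (\<Sum>a\<in>UNIV. ?x a * ?Qs a)"
    by (simp add: loss_def right_diff_distrib sum_subtractf sum_distrib_right[symmetric] sum_pmf_UNIV)
  ultimately have "loss (Suc k) s - Q_gap k s \<le> (\<Sum>a\<in>UNIV. (pmf p a - ?x a) * ?Q a)"
    by (simp add: algebra_simps sum_subtractf)
  then have "\<eta> * (loss (Suc k) s - Q_gap k s) \<le> \<eta> * (\<Sum>a\<in>UNIV. (pmf p a - ?x a) * ?Q a)"
    using step_size by simp
  with three_point_le[of p k s] show ?thesis by (simp add: algebra_simps)
qed

lemma loss_nonneg: "0 \<le> loss k s"
  unfolding loss_def using Q_star_le_V_star by (intro sum_nonneg mult_nonneg_nonneg) auto

lemma
  assumes supp: "\<And>a. a \<notin> optimal_actions P r \<gamma> s \<Longrightarrow> pmf p a = 0"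
  shows convergent_divergence: "convergent (\<lambda>k. divergence p (\<pi> k s))"
    and summable_loss: "summable (\<lambda>k. \<eta> * loss (Suc k) s)"
proof -
  note * = almost_decreasing_convergent[where d = "\<lambda>k. divergence p (\<pi> k s)"
      and m = "\<lambda>k. \<eta> * loss (Suc k) s" and e = "\<lambda>k. \<eta> * Q_gap k s",
      OF quasi_fejer[of s p, OF supp] divergence_nonneg[OF iterate_lt_1]
        mult_nonneg_nonneg[OF less_imp_le[OF step_size] loss_nonneg]
        mult_nonneg_nonneg[OF less_imp_le[OF step_size] Q_gap_nonneg]
        summable_mult[OF summable_Q_gap]]
  show "convergent (\<lambda>k. divergence p (\<pi> k s))" by (rule *(1))
  show "summable (\<lambda>k. \<eta> * loss (Suc k) s)" by (rule *(2))
qed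

text \<open>
  A nonoptimal action has a fixed positive suboptimality, so its mass is at most a constant times the loss, which
  is summable.
\<close>

lemma nonoptimal_tendsto_0:
  assumes a: "a \<notin> optimal_actions P r \<gamma> s"
  shows "(\<lambda>k. pmf (\<pi> k s) a) \<longlonglongrightarrow> 0"
proof -
  obtain b where b: "b \<in> optimal_actions P r \<gamma> s" using optimal_actions_nonempty by blast
  have "summable (\<lambda>k. \<eta> * loss (Suc k) s)"
    using b by (intro summable_loss[of s "return_pmf b"]) (auto simp: indicator_def)
  then have "(\<lambda>k. \<eta> * loss (Suc k) s) \<longlonglongrightarrow> 0" by (rule summable_LIMSEQ_zero)
  define c where "c = \<eta> * (V_star P r \<gamma> s - Q_star P r \<gamma> s a)"
  have c: "c > 0"
    using a Q_star_le_V_star[of s a] step_size by (auto simp: c_def optimal_actions_def)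
  have le: "pmf (\<pi> (Suc k) s) a \<le> \<eta> * loss (Suc k) s / c" for k
  proof -
    have "pmf (\<pi> (Suc k) s) a * (V_star P r \<gamma> s - Q_star P r \<gamma> s a) \<le> loss (Suc k) s"
      unfolding loss_def using Q_star_le_V_star
      by (intro member_le_sum[of a UNIV "\<lambda>a. pmf (\<pi> (Suc k) s) a * (V_star P r \<gamma> s - Q_star P r \<gamma> s a)"]) auto
    then have "pmf (\<pi> (Suc k) s) a * c \<le> \<eta> * loss (Suc k) s"
      using step_size by (simp add: c_def mult.left_commute)
    then show ?thesis using c by (simp add: field_simps)
  qed
  have "(\<lambda>k. pmf (\<pi> (Suc k) s) a) \<longlonglongrightarrow> 0"
  proof (rule tendsto_sandwich[of "\<lambda>_. 0"])
    show "(\<lambda>k. \<eta> * loss (Suc k) s / c) \<longlonglongrightarrow> 0"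
      using tendsto_divide_zero[OF \<open>(\<lambda>k. \<eta> * loss (Suc k) s) \<longlonglongrightarrow> 0\<close>] .
  qed (use le in auto)
  then show ?thesis by (rule LIMSEQ_imp_Suc)
qed

text \<open>
  The divergence from the point mass at the optimal action \<open>b\<close> converges, hence is bounded. Its
  summand at \<open>a\<close>, the divergence from 0, would be unbounded if the mass at \<open>a\<close> approached 1.
\<close>

lemma limit_point_lt_1:
  assumes b: "b \<in> optimal_actions P r \<gamma> s" "b \<noteq> a" and h: "strict_mono h"
    and lim: "(\<lambda>n. pmf (\<pi> (h n) s) a) \<longlonglongrightarrow> l"
  shows "l < 1"
proof (rule ccontr)
  assume "\<not> l < 1"
  moreover have "l \<le> 1" using lim by (rule LIMSEQ_le_const2) (auto simp: pmf_le_1)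
  ultimately have l: "l = 1" by simp
  let ?p = "return_pmf b"
  have "convergent (\<lambda>k. divergence ?p (\<pi> k s))"
    using b by (intro convergent_divergence) (auto simp: indicator_def)
  from convergent_imp_Bseq[OF this]
  obtain B where B: "\<And>k. \<bar>divergence ?p (\<pi> k s)\<bar> \<le> B"
    by (auto simp: Bseq_def)
  have "breg 0 (pmf (\<pi> (h n) s) a) \<le> B" for n
  proof -
    have "pmf ?p a = 0" using b(2) by (simp add: indicator_def)
    then show ?thesis
      using breg_le_divergence[of "\<pi> (h n) s" ?p a, OF iterate_lt_1] B[of "h n"] by simp
  qed
  then have "\<not> (\<lambda>n. pmf (\<pi> (h n) s) a) \<longlonglongrightarrow> 1"
    using iterate_lt_1 by (intro breg_0_bounded_away_from_1) auto
  with lim l show False by simp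
qed

text \<open>
  The divergence from \<open>q\<close> converges along the whole sequence and tends to 0 along a subsequence, so it tends
  to 0. It dominates the divergence in each coordinate.
\<close>

lemma convergent_to_limit_point:
  assumes h: "strict_mono h"
    and lim: "\<And>a. (\<lambda>n. pmf (\<pi> (h n) s) a) \<longlonglongrightarrow> pmf q a"
    and supp: "\<And>a. a \<notin> optimal_actions P r \<gamma> s \<Longrightarrow> pmf q a = 0"
    and lt: "\<And>a. pmf q a < 1"
  shows "(\<lambda>k. pmf (\<pi> k s) a) \<longlonglongrightarrow> pmf q a"
proof -
  have x: "pmf (\<pi> k s) a \<in> {0..<1}" for k a using iterate_lt_1 by simp
  have q: "pmf q a \<in> {0..<1}" for a using lt by simp
  have "(\<lambda>n. divergence q (\<pi> (h n) s)) \<longlonglongrightarrow> (\<Sum>a\<in>(UNIV :: 'a set). 0)"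
    unfolding divergence_def by (intro tendsto_sum breg_tendsto_0 q x lim)
  moreover obtain L where L: "(\<lambda>k. divergence q (\<pi> k s)) \<longlonglongrightarrow> L"
    using convergent_divergence[of s q] supp unfolding convergent_def by blast
  ultimately have "L = 0"
    using LIMSEQ_unique LIMSEQ_subseq_LIMSEQ[OF L h] by (fastforce simp: o_def)
  have "(\<lambda>k. breg (pmf q a) (pmf (\<pi> k s) a)) \<longlonglongrightarrow> 0"
  proof (rule tendsto_sandwich[of "\<lambda>_. 0"])
    show "(\<lambda>k. divergence q (\<pi> k s)) \<longlonglongrightarrow> 0" using L \<open>L = 0\<close> by simp
    show "\<forall>\<^sub>F k in sequentially. breg (pmf q a) (pmf (\<pi> k s) a) \<le> divergence q (\<pi> k s)"
      by (intro always_eventually allI breg_le_divergence iterate_lt_1)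
    show "\<forall>\<^sub>F k in sequentially. 0 \<le> breg (pmf q a) (pmf (\<pi> k s) a)"
      by (intro always_eventually allI breg_nonneg pmf_unit x)
  qed simp
  then show ?thesis by (rule tendsto_of_breg_tendsto_0[OF q x])
qed

text \<open>
  Compactness of the unit cube, with policies at \<open>s\<close> read as vectors.
\<close>

lemma exists_limit_point:
  "\<exists>q h. strict_mono (h :: nat \<Rightarrow> nat) \<and> (\<forall>a. (\<lambda>n. pmf (\<pi> (h n) s) a) \<longlonglongrightarrow> pmf q a)"
proof -
  define x :: "nat \<Rightarrow> real ^ 'a" where "x k = (\<chi> a. pmf (\<pi> k s) a)" for k
  have "x k \<in> cbox 0 1" for k by (auto simp: x_def mem_box_cart pmf_le_1)
  moreover have "seq_compact (cbox 0 1 :: (real ^ 'a) set)"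
    by (intro compact_imp_seq_compact compact_cbox)
  ultimately obtain l h where h: "strict_mono h" and l: "(x \<circ> h) \<longlonglongrightarrow> l"
    by (metis seq_compactE)
  have lim: "(\<lambda>n. pmf (\<pi> (h n) s) a) \<longlonglongrightarrow> l $ a" for a
    using tendsto_vec_nth[OF l, of a] by (simp add: x_def o_def)
  have "\<exists>q. \<forall>a. pmf q a = l $ a"
  proof (rule exists_pmf_with_weights)
    show "0 \<le> l $ a" for a using lim by (rule LIMSEQ_le_const) auto
    have "(\<lambda>n. \<Sum>a\<in>UNIV. pmf (\<pi> (h n) s) a) \<longlonglongrightarrow> (\<Sum>a\<in>UNIV. l $ a)"
      by (intro tendsto_sum lim)
    then show "(\<Sum>a\<in>UNIV. l $ a) = 1"
      by (simp add: sum_pmf_UNIV LIMSEQ_const_iff)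
  qed
  then show ?thesis using h lim by metis
qed

text \<open>
  With a unique optimal action the limit is the point mass there. That case is treated separately, since the
  divergence argument covers only limits with all probabilities below 1.
\<close>

lemma iterates_converge:
  "\<exists>q. (\<forall>a. (\<lambda>k. pmf (\<pi> k s) a) \<longlonglongrightarrow> pmf q a) \<and>
    (\<forall>a. a \<notin> optimal_actions P r \<gamma> s \<longrightarrow> pmf q a = 0) \<and>
    (card (optimal_actions P r \<gamma> s) > 1 \<longrightarrow> (\<forall>a. pmf q a < 1))"
proof -
  let ?A = "optimal_actions P r \<gamma> s"
  have "card ?A \<noteq> 0" using optimal_actions_nonempty by simp
  then consider "card ?A = 1" | "card ?A > 1" by linarith
  then show ?thesis
  proof cases
    case 1
    then obtain b where b: "?A = {b}" by (auto simp: card_1_singleton_iff)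
    have "(\<lambda>k. 1 - (\<Sum>a\<in>UNIV - {b}. pmf (\<pi> k s) a)) \<longlonglongrightarrow> 1 - (\<Sum>a\<in>UNIV - {b}. 0)"
      using b by (intro tendsto_intros nonoptimal_tendsto_0) auto
    moreover have "1 - (\<Sum>a\<in>UNIV - {b}. pmf (\<pi> k s) a) = pmf (\<pi> k s) b" for k
      using sum_pmf_UNIV[of "\<pi> k s"] sum.remove[of UNIV b "pmf (\<pi> k s)"] by simp
    ultimately have "(\<lambda>k. pmf (\<pi> k s) b) \<longlonglongrightarrow> 1" by simp
    then have "(\<lambda>k. pmf (\<pi> k s) a) \<longlonglongrightarrow> pmf (return_pmf b) a" for a
      using nonoptimal_tendsto_0[of a s] b by (cases "a = b") auto
    then show ?thesis using 1 b by (intro exI[of _ "return_pmf b"]) auto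
  next
    case 2
    obtain q h where h: "strict_mono (h :: nat \<Rightarrow> nat)"
      and lim: "\<And>a. (\<lambda>n. pmf (\<pi> (h n) s) a) \<longlonglongrightarrow> pmf q a"
      using exists_limit_point[of s] by blast
    have supp: "pmf q a = 0" if "a \<notin> ?A" for a
      using LIMSEQ_unique[OF lim] LIMSEQ_subseq_LIMSEQ[OF nonoptimal_tendsto_0[OF that] h]
      by (simp add: o_def)
    have lt: "pmf q a < 1" for a
    proof -
      have "\<not> ?A \<subseteq> {a}" using 2 card_mono[of "{a}" ?A] by auto
      then obtain b where "b \<in> ?A" "b \<noteq> a" by blast
      then show ?thesis using h lim by (rule limit_point_lt_1)
    qed
    show ?thesis
      using convergent_to_limit_point[OF h lim supp lt] supp lt by blast
  qed
qed

end

theorem theorem3p12: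
  fixes P :: "'s::finite \<Rightarrow> 'a::finite \<Rightarrow> 's pmf"
    and r :: "'s \<Rightarrow> 'a \<Rightarrow> real"
    and \<gamma> \<eta> :: real
    and \<psi> :: "real \<Rightarrow> ereal"
    and \<pi> :: "nat \<Rightarrow> 's \<Rightarrow> 'a pmf"
  assumes reward: "\<And>s a. r s a \<in> {0..1}"
    and discount: "\<gamma> \<in> {0..<1}"
    and S_tilde_nonempty: "{s. optimal_actions P r \<gamma> s \<noteq> UNIV} \<noteq> {}"
    and mirror_map: "mirror_map \<psi>"
    and step_size: "\<eta> > 0"
    and pmd: "pmd_sequence P r \<gamma> \<psi> \<eta> \<pi>"
    and deriv_0: "deriv_0_plus \<psi> > -\<infinity>"
    and deriv_1: "deriv_1_minus \<psi> = \<infinity>"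
  shows "\<exists>\<pi>_lim.
    (\<forall>s a. (\<lambda>k. pmf (\<pi> k s) a) \<longlonglongrightarrow> pmf (\<pi>_lim s) a) \<and>
    \<pi>_lim \<in> optimal_policies P r \<gamma> \<and>
    (\<forall>s a. a \<notin> optimal_actions P r \<gamma> s \<longrightarrow> pmf (\<pi>_lim s) a = 0) \<and>
    (\<forall>s. card (optimal_actions P r \<gamma> s) = 1 \<longrightarrow>
      (\<forall>a\<in>optimal_actions P r \<gamma> s. pmf (\<pi>_lim s) a = 1)) \<and>
    (\<forall>s. card (optimal_actions P r \<gamma> s) > 1 \<longrightarrow>
      (\<forall>a\<in>optimal_actions P r \<gamma> s. pmf (\<pi>_lim s) a \<in> interior (effective_domain \<psi>)))"
proof -
  interpret pmd P r \<gamma> \<psi> \<eta> \<pi>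
    using discount mirror_map deriv_0 deriv_1 step_size pmd by unfold_locales
  let ?limit = "\<lambda>s q. (\<forall>a. (\<lambda>k. pmf (\<pi> k s) a) \<longlonglongrightarrow> pmf q a) \<and>
      (\<forall>a. a \<notin> optimal_actions P r \<gamma> s \<longrightarrow> pmf q a = 0) \<and>
      (card (optimal_actions P r \<gamma> s) > 1 \<longrightarrow> (\<forall>a. pmf q a < 1))"
  have "\<forall>s. \<exists>q. ?limit s q" by (intro allI iterates_converge)
  then obtain q where "\<forall>s. ?limit s (q s)" using choice[of ?limit] by blast
  then have lim: "\<And>s a. (\<lambda>k. pmf (\<pi> k s) a) \<longlonglongrightarrow> pmf (q s) a"
    and supp: "\<And>s a. a \<notin> optimal_actions P r \<gamma> s \<Longrightarrow> pmf (q s) a = 0"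
    and lt: "\<And>s a. card (optimal_actions P r \<gamma> s) > 1 \<Longrightarrow> pmf (q s) a < 1"
    by blast+
  have one: "pmf (q s) a = 1" if "card (optimal_actions P r \<gamma> s) = 1" "a \<in> optimal_actions P r \<gamma> s" for s a
  proof -
    from that have A: "optimal_actions P r \<gamma> s = {a}"
      by (auto simp: card_1_singleton_iff)
    have "set_pmf (q s) \<subseteq> {a}"
    proof
      fix b assume "b \<in> set_pmf (q s)"
      then show "b \<in> {a}" using supp[of b s] unfolding A set_pmf_iff by blast
    qed
    then have "(\<Sum>b\<in>{a}. pmf (q s) b) = 1" by (intro sum_pmf_eq_1) auto
    then show ?thesis by simp
  qed
  have "q \<in> optimal_policies P r \<gamma>"
    using supp by (rule optimal_if_supported)
  then show ?thesis
    using lim supp one lt by (intro exI[of _ q]) (auto simp: interior_iff[OF pmf_unit])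
qed

end
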